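(* Let $n\geq 1$ and let $w\in F_n$ be a cyclically reduced word such that the cyclic presentation $P_n(w)$ is non-redundant, where $w$ is non-negative (i.e. not a negative word), has length $l(w)\geq 3$, and is not a proper power. Then: (a) if $P_n(w)$ satisfies the small cancellation condition $T(q)$ where $q\geq 7$, then $l(w)=3$, $q\leq 8$, and $w$ is non-positive (i.e. not a positive word); (b) if $w$ is a non-positive word of length $k=3$ then $P_n(w)$ is not $(m,k,\nu)$-special for any $m\geq 2$, $\nu\geq 1$. Hence, if $P_n(w)$ is $(m,k,\nu)$-special for some $m\geq 2$, $k\geq 3$, $\nu\geq 1$, then either $m=2$, or ($m=3$ and $w$ is positive).
   Context: Cyclic presentations: $F_n$ is the free group with basis $x_0,\ldots,x_{n-1}$ and $\theta:F_n\to F_n$ is the automorphism $\theta(x_i)=x_{i+1}$ (subscripts mod $n$). For a cyclically reduced word $w\in F_n$, $P_n(w)=\langle x_0,\ldots,x_{n-1}\mid w,\theta(w),\ldots,\theta^{n-1}(w)\rangle$. Throughout it is assumed that $x_0$ is a letter of $w$. A word is positive (negative) if all exponents of its generators are positive (negative). The word $w$ is a proper power if $w=v^t$ for some $v$ and some $t\geq 2$. Non-redundant: a relator $r\in R$ of $\langle X\mid R\rangle$ is freely redundant if it is freely trivial or there is $s\in R$ such that $r,s$ are distinct elements of the free group on $X$ and $r$ is freely conjugate to $s$ or to $s^{-1}$. A presentation is redundant if it contains a freely redundant relator, and non-redundant otherwise. Condition $T(q)$: let $\tilde R$ be the symmetrized closure of $R$ (all cyclic permutations of elements of $R\cup R^{-1}$).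 $T(q)$ holds if for every $3\leq h<q$ and all $r_1,\ldots,r_h\in\tilde R$ with $r_i\neq r_{i+1}^{-1}$ for all $i$ (indices mod $h$), at least one of the products $r_1r_2,\ r_2r_3,\ldots,r_{h-1}r_h,\ r_hr_1$ is reduced without cancellation. Star graph: the star graph of $\langle X\mid R\rangle$ (all relators cyclically reduced) is the undirected graph, possibly with multiple edges, with vertex set $X\cup X^{-1}$ and an edge joining $x$ and $y$ for each distinct word of the form $xy^{-1}u$ in $\tilde R$, where the edges corresponding to the inverse pair $xy^{-1}u$, $yx^{-1}u^{-1}$ are identified. Special presentations: let $m\geq 2$, $k\geq 3$, $\nu\geq 1$. A finite presentation $\langle X\mid R\rangle$ is $(m,k,\nu)$-special if (a) its star graph has exactly $\nu$ connected components, which are pairwise isomorphic, each a connected bipartite graph of diameter $m$ and girth $2m$ in which each vertex has degree at least $3$; (b) each relator has length $k$; (c) if $m=2$ then $k\geq 4$. Girth is the length of a shortest closed path in which consecutive edges are never equal (so a pair of parallel edges gives such a path of length $2$). *)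

theory Defs
  imports "HOL-Algebra.Group" "HOL-Library.Extended_Nat" "Graph_Theory.Graph_Theory"
begin

section \<open>Free groups\<close>

datatype 'a letter = is_pos: Pos (gen_of: 'a) | is_neg: Neg (gen_of: 'a)

type_synonym 'a word = "'a letter list"

fun flip :: "'a letter \<Rightarrow> 'a letter" where
  "flip (Pos x) = Neg x"
| "flip (Neg x) = Pos x"

definition inv_word :: "'a word \<Rightarrow> 'a word" where
  "inv_word u = rev (map flip u)"

definition reduced :: "'a word \<Rightarrow> bool" where
  "reduced u \<longleftrightarrow> successively (\<lambda>a b. b \<noteq> flip a) u"

definition cyclically_reduced :: "'a word \<Rightarrow> bool" where
  "cyclically_reduced u \<longleftrightarrow> reduced u \<and> (u \<noteq> [] \<longrightarrow> hd u \<noteq> flip (last u))"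

fun cons_red :: "'a letter \<Rightarrow> 'a word \<Rightarrow> 'a word" where
  "cons_red a [] = [a]"
| "cons_red a (b # u) = (if b = flip a then u else a # b # u)"

definition reduce :: "'a word \<Rightarrow> 'a word" where
  "reduce u = foldr cons_red u []"

text \<open>An element of the free group on \<open>X\<close> is represented by its unique reduced word, so that
  equality of list terms is equality in the free group.\<close>

definition free_group :: "'a set \<Rightarrow> 'a word monoid" where
  "free_group X =
     \<lparr>carrier = {u. reduced u \<and> gen_of ` set u \<subseteq> X}, monoid.mult = (\<lambda>u v. reduce (u @ v)), one = []\<rparr>"

lemma flip_flip [simp]: "flip (flip a) = a"
  by (cases a) auto

lemma flip_neq [simp]: "flip a \<noteq> a" "a \<noteq> flip a"
  by (cases a; simp)+

lemma gen_of_flip [simp]: "gen_of (flip a) = gen_of a"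
  by (cases a) auto

lemma inv_word_inv_word [simp]: "inv_word (inv_word u) = u"
  by (simp add: inv_word_def rev_map comp_def)

lemma gens_inv_word [simp]: "gen_of ` set (inv_word u) = gen_of ` set u"
  by (simp add: inv_word_def image_image)

lemma reduced_Nil [simp]: "reduced []"
  by (simp add: reduced_def)

lemma reduced_Cons: "reduced (a # u) \<longleftrightarrow> reduced u \<and> (u \<noteq> [] \<longrightarrow> hd u \<noteq> flip a)"
  by (cases u) (auto simp: reduced_def)

lemma reduced_inv_word [simp]: "reduced (inv_word u) \<longleftrightarrow> reduced u"
proof -
  have "successively (\<lambda>a b. flip a \<noteq> b) u \<longleftrightarrow> successively (\<lambda>a b. b \<noteq> flip a) u"
    by (rule successively_cong) auto
  then show ?thesis
    by (simp add: reduced_def inv_word_def successively_map)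
qed

lemma reduced_cons_red: "reduced u \<Longrightarrow> reduced (cons_red a u)"
  by (cases u) (auto simp: reduced_Cons)

lemma cons_red_flip: "reduced u \<Longrightarrow> cons_red a (cons_red (flip a) u) = u"
  by (cases u; cases "tl u") (auto simp: reduced_Cons)

lemma reduced_foldr: "reduced v \<Longrightarrow> reduced (foldr cons_red u v)"
  by (induction u) (auto simp: reduced_cons_red)

lemma reduced_reduce [simp]: "reduced (reduce u)"
  by (simp add: reduce_def reduced_foldr)

lemma reduce_id: "reduced u \<Longrightarrow> reduce u = u"
  unfolding reduce_def
proof (induction u)
  case (Cons a u)
  then show ?case by (cases u) (auto simp: reduced_Cons)
qed simp

lemma foldr_reduce: "reduced v \<Longrightarrow> foldr cons_red (reduce u) v = foldr cons_red u v"
proof (induction u)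
  case (Cons a u)
  have eq: "reduce (a # u) = cons_red a (reduce u)" by (simp add: reduce_def)
  show ?case
  proof (cases "reduce u")
    case Nil
    then show ?thesis using Cons by (simp add: eq)
  next
    case C: (Cons b w)
    then have IH: "foldr cons_red u v = cons_red b (foldr cons_red w v)"
      using Cons by simp
    show ?thesis
      by (simp add: eq C IH cons_red_flip reduced_foldr Cons.prems)
  qed
qed (simp add: reduce_def)

lemma reduce_append: "reduce (u @ v) = foldr cons_red u (reduce v)"
  by (simp add: reduce_def)

lemma reduce_reduce_append: "reduce (reduce u @ v) = reduce (u @ v)"
  by (simp add: reduce_append foldr_reduce)

lemma reduce_append_reduce: "reduce (u @ reduce v) = reduce (u @ v)"
  by (simp add: reduce_append reduce_id)

lemma set_cons_red: "set (cons_red a u) \<subseteq> insert a (set u)"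
  by (cases u) auto

lemma set_reduce: "set (reduce u) \<subseteq> set u"
proof (induction u)
  case (Cons a u)
  then show ?case using set_cons_red[of a "reduce u"] by (auto simp: reduce_def)
qed (simp add: reduce_def)

lemma reduce_inv_word_append: "reduce (inv_word u @ u) = []"
proof (induction u)
  case (Cons a u)
  have "reduce (inv_word (a # u) @ a # u) =
        foldr cons_red (inv_word u) (cons_red (flip a) (cons_red a (reduce u)))"
    by (simp add: inv_word_def reduce_def)
  also have "\<dots> = reduce (inv_word u @ u)"
    using cons_red_flip[of "reduce u" "flip a"] by (simp add: reduce_append)
  finally show ?case using Cons by simp
qed (simp add: inv_word_def reduce_def)

lemma group_free_group: "group (free_group X)"
proof (rule groupI)
  fix u v assume "u \<in> carrier (free_group X)" "v \<in> carrier (free_group X)"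
  then show "u \<otimes>\<^bsub>free_group X\<^esub> v \<in> carrier (free_group X)"
    using set_reduce[of "u @ v"] by (fastforce simp: free_group_def)
next
  fix u assume "u \<in> carrier (free_group X)"
  then show "\<exists>v\<in>carrier (free_group X). v \<otimes>\<^bsub>free_group X\<^esub> u = \<one>\<^bsub>free_group X\<^esub>"
    by (intro bexI[of _ "inv_word u"]) (auto simp: free_group_def reduce_inv_word_append)
qed (auto simp: free_group_def reduce_id reduce_reduce_append reduce_append_reduce)

lemma inv_free_group:
  assumes "u \<in> carrier (free_group X)"
  shows "inv\<^bsub>free_group X\<^esub> u = inv_word u"
proof -
  interpret group "free_group X" by (rule group_free_group)
  show ?thesis
    using assms by (intro inv_equality) (auto simp: free_group_def reduce_inv_word_append)
qed

definition positive :: "'a word \<Rightarrow> bool" where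
  "positive u \<longleftrightarrow> (\<forall>a\<in>set u. is_pos a)"

definition negative :: "'a word \<Rightarrow> bool" where
  "negative u \<longleftrightarrow> (\<forall>a\<in>set u. is_neg a)"

definition proper_power :: "'a set \<Rightarrow> 'a word \<Rightarrow> bool" where
  "proper_power X u \<longleftrightarrow>
     (\<exists>v\<in>carrier (free_group X). \<exists>t::nat. t \<ge> 2 \<and> u = v [^]\<^bsub>free_group X\<^esub> t)"

definition freely_conjugate :: "'a set \<Rightarrow> 'a word \<Rightarrow> 'a word \<Rightarrow> bool" where
  "freely_conjugate X r s \<longleftrightarrow>
     (\<exists>g\<in>carrier (free_group X).
        r = g \<otimes>\<^bsub>free_group X\<^esub> s \<otimes>\<^bsub>free_group X\<^esub> inv\<^bsub>free_group X\<^esub> g)"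


section \<open>Presentations\<close>

text \<open>A pair \<open>(X, R)\<close> of generators and relators, the latter being elements of the free group
  on \<open>X\<close>.\<close>

type_synonym 'a presentation = "'a set \<times> 'a word set"

definition freely_redundant :: "'a presentation \<Rightarrow> 'a word \<Rightarrow> bool" where
  "freely_redundant P r \<longleftrightarrow> (case P of (X, R) \<Rightarrow>
     r \<in> R \<and>
     (r = \<one>\<^bsub>free_group X\<^esub> \<or>
      (\<exists>s\<in>R. r \<noteq> s \<and>
         (freely_conjugate X r s \<or> freely_conjugate X r (inv\<^bsub>free_group X\<^esub> s)))))"

definition redundant :: "'a presentation \<Rightarrow> bool" where
  "redundant P \<longleftrightarrow> (\<exists>r. freely_redundant P r)"

definition symmetrized_closure :: "'a word set \<Rightarrow> 'a word set" where
  "symmetrized_closure R = {rotate i r | i r. r \<in> R \<union> inv_word ` R}"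

text \<open>The indices \<open>1, \<dots>, h\<close> are shifted to \<open>0, \<dots>, h - 1\<close>.\<close>

definition T_condition :: "nat \<Rightarrow> 'a presentation \<Rightarrow> bool" where
  "T_condition q P \<longleftrightarrow> (case P of (X, R) \<Rightarrow>
     \<forall>h r. 3 \<le> h \<and> h < q \<and>
       (\<forall>i<h. r i \<in> symmetrized_closure R) \<and>
       (\<forall>i<h. r i \<noteq> inv_word (r (Suc i mod h))) \<longrightarrow>
       (\<exists>i<h. reduced (r i @ r (Suc i mod h))))"


section \<open>Star graphs\<close>

text \<open>An undirected multigraph is a digraph with an involution on its arcs that exchanges tail and
  head; an edge is a pair consisting of an arc and its reverse. In the star graph the arcs from
  \<open>x\<close> to \<open>y\<close> are the words \<open>x y\<inverse> u\<close> of the symmetrized closure, and the reverse of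
  \<open>x y\<inverse> u\<close> is \<open>y x\<inverse> u\<inverse>\<close>.\<close>

definition star_graph :: "'a presentation \<Rightarrow> ('a letter, 'a word) pre_digraph" where
  "star_graph P = (case P of (X, R) \<Rightarrow>
     \<lparr>verts = Pos ` X \<union> Neg ` X,
      arcs = {r \<in> symmetrized_closure R. length r \<ge> 2},
      tail = (\<lambda>r. r ! 0),
      head = (\<lambda>r. flip (r ! 1))\<rparr>)"

fun rev_arc :: "'a word \<Rightarrow> 'a word" where
  "rev_arc (a # b # u) = flip b # flip a # inv_word u"
| "rev_arc u = u"

lemma cyclically_reduced_inv_word:
  assumes "cyclically_reduced u"
  shows "cyclically_reduced (inv_word u)"
proof (cases "u = []")
  case False
  then have "hd (inv_word u) = flip (last u)" "last (inv_word u) = flip (hd u)"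
    by (simp_all add: inv_word_def hd_rev last_rev last_map hd_map)
  then show ?thesis
    using assms False by (auto simp: cyclically_reduced_def)
qed (simp add: cyclically_reduced_def inv_word_def)

lemma cyclically_reduced_rotate: "cyclically_reduced u \<Longrightarrow> cyclically_reduced (rotate i u)"
proof (induction i)
  case (Suc i)
  have "cyclically_reduced (rotate1 v)" if "cyclically_reduced v" for v :: "'a word"
  proof (cases v)
    case (Cons a v')
    have "reduced (v' @ [a]) \<longleftrightarrow> reduced v' \<and> (v' \<noteq> [] \<longrightarrow> a \<noteq> flip (last v'))"
      by (auto simp: reduced_def successively_append_iff)
    then show ?thesis
      using that
      by (cases "v' = []") (auto simp: Cons cyclically_reduced_def reduced_Cons)
  qed (simp add: cyclically_reduced_def)
  then show ?case using Suc by simp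
qed simp

lemma length_inv_word [simp]: "length (inv_word u) = length u"
  by (simp add: inv_word_def)

lemma inv_word_rotate: "\<exists>i. inv_word (rotate j s) = rotate i (inv_word s)"
proof (induction j)
  case (Suc j)
  have "\<exists>i. inv_word (rotate1 v) = rotate i (inv_word v)" for v :: "'a word"
  proof (cases v)
    case (Cons a v')
    then have "inv_word (rotate1 v) = rotate (length v') (inv_word v)"
      using rotate_append[of "inv_word v'" "[flip a]"] by (simp add: inv_word_def)
    then show ?thesis ..
  qed (simp add: inv_word_def)
  then show ?case using Suc by (metis rotate_Suc rotate_rotate)
qed (auto intro: exI[of _ 0])

lemma symmetrized_closure_inv_word:
  assumes "r \<in> symmetrized_closure R"
  shows "rotate i (inv_word r) \<in> symmetrized_closure R"
proof -
  obtain j s where s: "s \<in> R \<union> inv_word ` R" and r: "r = rotate j s"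
    using assms by (auto simp: symmetrized_closure_def)
  obtain k where "inv_word r = rotate k (inv_word s)"
    using inv_word_rotate r by blast
  moreover have "inv_word s \<in> R \<union> inv_word ` R" using s by auto
  ultimately show ?thesis
    unfolding symmetrized_closure_def by (auto simp: rotate_rotate)
qed

lemma rev_arc_eq_rotate:
  assumes "length r \<ge> 2"
  shows "rev_arc r = rotate (length r - 2) (inv_word r)"
proof -
  obtain a b u where "r = a # b # u"
    using assms by (cases r rule: rev_arc.cases) auto
  then show ?thesis
    using rotate_append[of "inv_word u" "[flip b, flip a]"] by (simp add: inv_word_def)
qed

lemma bidirected_star_graph:
  assumes "R \<subseteq> carrier (free_group X)" "\<And>r. r \<in> R \<Longrightarrow> cyclically_reduced r"
  shows "bidirected_digraph (star_graph (X, R))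
           (\<lambda>r. if r \<in> arcs (star_graph (X, R)) then rev_arc r else r)"
    and "loopfree_digraph (star_graph (X, R))"
proof -
  let ?G = "star_graph (X, R)"
  have gens: "gen_of ` set r \<subseteq> X" and red: "cyclically_reduced r"
    if mem: "r \<in> symmetrized_closure R" for r
  proof -
    obtain i s where s: "s \<in> R" and r: "r = rotate i s \<or> r = rotate i (inv_word s)"
      using mem unfolding symmetrized_closure_def by blast
    have "gen_of ` set s \<subseteq> X" using s assms(1) by (auto simp: free_group_def)
    then show "gen_of ` set r \<subseteq> X" using r by (elim disjE) simp_all
    show "cyclically_reduced r"
      using r assms(2)[OF s]
      by (auto intro: cyclically_reduced_rotate cyclically_reduced_inv_word)
  qed
  have verts: "a \<in> verts ?G" if "gen_of a \<in> X" for a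
    using that by (cases a) (auto simp: star_graph_def)
  have split_arc: "\<exists>a b u. r = a # b # u \<and> b \<noteq> flip a \<and> gen_of a \<in> X \<and> gen_of b \<in> X"
    if "r \<in> arcs ?G" for r
    using that gens[of r] red[of r]
    by (cases r rule: rev_arc.cases)
      (auto simp: star_graph_def cyclically_reduced_def reduced_Cons)
  have rev: "rev_arc r \<in> arcs ?G" if "r \<in> arcs ?G" for r
    using that symmetrized_closure_inv_word[of r R]
    by (auto simp: star_graph_def rev_arc_eq_rotate)
  have ends: "tail ?G r = r ! 0" "head ?G r = flip (r ! 1)" for r
    by (simp_all add: star_graph_def)
  interpret wf_digraph ?G
  proof
    fix r assume "r \<in> arcs ?G"
    from split_arc[OF this] show "tail ?G r \<in> verts ?G" "head ?G r \<in> verts ?G"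
      by (auto simp: ends intro: verts)
  qed
  show "loopfree_digraph ?G"
  proof
    fix r assume "r \<in> arcs ?G"
    from split_arc[OF this] show "tail ?G r \<noteq> head ?G r"
      by (auto simp: ends)
  qed
  have "rev_arc r \<noteq> r \<and> rev_arc (rev_arc r) = r \<and> tail ?G (rev_arc r) = head ?G r"
    if "r \<in> arcs ?G" for r
    using split_arc[OF that] by (auto simp: ends)
  then show "bidirected_digraph ?G (\<lambda>r. if r \<in> arcs ?G then rev_arc r else r)"
    using rev by (intro bidirected_digraphI) simp_all
qed

text \<open>In a loop-free graph two consecutive arcs of a walk traverse the same edge if and only if the
  second is the reverse of the first.\<close>

definition girth :: "('b \<Rightarrow> 'b) \<Rightarrow> ('a, 'b) pre_digraph \<Rightarrow> enat" where
  "girth arev G = (INF p\<in>{p. wf_digraph.closed_w G p \<and>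
     (\<forall>i<length p. p ! (Suc i mod length p) \<noteq> arev (p ! i))}. enat (length p))"

definition graph_dist :: "('a, 'b) pre_digraph \<Rightarrow> 'a \<Rightarrow> 'a \<Rightarrow> enat" where
  "graph_dist G u v = (INF p\<in>{p. pre_digraph.awalk G u p v}. enat (length p))"

definition diameter :: "('a, 'b) pre_digraph \<Rightarrow> enat" where
  "diameter G = (SUP (u, v)\<in>verts G \<times> verts G. graph_dist G u v)"

definition bipartite :: "('a, 'b) pre_digraph \<Rightarrow> bool" where
  "bipartite G \<longleftrightarrow> (\<exists>A B. verts G = A \<union> B \<and> A \<inter> B = {} \<and>
     (\<forall>e\<in>arcs G. tail G e \<in> A \<and> head G e \<in> B \<or> tail G e \<in> B \<and> head G e \<in> A))"

text \<open>As the arcs of a star graph come in mutually reverse pairs, its connected components are its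
  strongly connected ones; as there are no loops, the degree of a vertex is its out-degree.\<close>

definition special :: "nat \<Rightarrow> nat \<Rightarrow> nat \<Rightarrow> 'a presentation \<Rightarrow> bool" where
  "special m k \<nu> P \<longleftrightarrow> (case P of (X, R) \<Rightarrow>
     finite X \<and> finite R \<and> R \<subseteq> carrier (free_group X) \<and> (\<forall>r\<in>R. cyclically_reduced r) \<and>
     finite (pre_digraph.sccs (star_graph P)) \<and> card (pre_digraph.sccs (star_graph P)) = \<nu> \<and>
     (\<forall>C\<in>pre_digraph.sccs (star_graph P). \<forall>D\<in>pre_digraph.sccs (star_graph P).
        digraph_iso C D) \<and>
     (\<forall>C\<in>pre_digraph.sccs (star_graph P).
        bipartite C \<and> diameter C = enat m \<and> girth rev_arc C = enat (2 * m) \<and>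
        (\<forall>v\<in>verts C. out_degree C v \<ge> 3)) \<and>
     (\<forall>r\<in>R. length r = k) \<and>
     (m = 2 \<longrightarrow> k \<ge> 4))"


section \<open>Cyclic presentations\<close>

definition shift :: "nat \<Rightarrow> nat word \<Rightarrow> nat word" where
  "shift n = map (map_letter (\<lambda>i. Suc i mod n))"

lemma map_letter_flip: "map_letter f (flip a) = flip (map_letter f a)"
  by (cases a) auto

lemma gen_of_map_letter [simp]: "gen_of (map_letter f a) = f (gen_of a)"
  by (cases a) auto

lemma map_letter_eq_iff:
  "inj_on f X \<Longrightarrow> gen_of a \<in> X \<Longrightarrow> gen_of b \<in> X \<Longrightarrow> map_letter f a = map_letter f b \<longleftrightarrow> a = b"
  by (cases a; cases b) (auto simp: inj_on_def)

lemma reduce_map_letter: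
  assumes "inj_on f X" "gen_of ` set u \<subseteq> X"
  shows "reduce (map (map_letter f) u) = map (map_letter f) (reduce u)"
  using assms(2)
proof (induction u)
  case (Cons a u)
  have IH: "reduce (map (map_letter f) u) = map (map_letter f) (reduce u)"
    using Cons by auto
  have eq: "reduce (c # v) = cons_red c (reduce v)" for c :: "'c letter" and v
    by (simp add: reduce_def)
  have sub: "gen_of ` set (reduce u) \<subseteq> X"
    using Cons.prems set_reduce[of u] by auto
  show ?case
  proof (cases "reduce u")
    case (Cons b v)
    then have "map_letter f b = map_letter f (flip a) \<longleftrightarrow> b = flip a"
      using sub Cons.prems by (intro map_letter_eq_iff[OF assms(1)]) auto
    then show ?thesis
      using Cons by (simp add: eq IH map_letter_flip)
  qed (simp add: eq IH)
qed (simp add: reduce_def)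

lemma map_letter_hom:
  assumes "inj_on f X" "f ` X \<subseteq> Y"
  shows "map (map_letter f) \<in> hom (free_group X) (free_group Y)"
proof (rule homI)
  fix u assume u: "u \<in> carrier (free_group X)"
  then have "reduce (map (map_letter f) u) = map (map_letter f) u"
    by (simp add: free_group_def reduce_map_letter[OF assms(1)] reduce_id)
  then have "reduced (map (map_letter f) u)"
    by (metis reduced_reduce)
  then show "map (map_letter f) u \<in> carrier (free_group Y)"
    using u assms(2) by (fastforce simp: free_group_def)
next
  fix u v assume "u \<in> carrier (free_group X)" "v \<in> carrier (free_group X)"
  then show "map (map_letter f) (u \<otimes>\<^bsub>free_group X\<^esub> v) =
      map (map_letter f) u \<otimes>\<^bsub>free_group Y\<^esub> map (map_letter f) v"
    by (simp add: free_group_def image_Un flip: reduce_map_letter[OF assms(1)])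
qed

lemma shift_iso:
  assumes "n \<ge> 1"
  shows "shift n \<in> iso (free_group {..<n}) (free_group {..<n})"
proof -
  let ?C = "carrier (free_group {..<n})"
  let ?f = "\<lambda>i. Suc i mod n" and ?g = "\<lambda>i. (i + (n - 1)) mod n"
  have gf: "?g (?f i) = i" if "i < n" for i
    using that by (cases "Suc i = n") auto
  have fg: "?f (?g i) = i" if "i < n" for i
    using that by (cases i) auto
  have "inj_on ?f {..<n}"
    by (rule inj_on_inverseI[where g = ?g]) (use gf in simp)
  moreover have "inj_on ?g {..<n}"
    by (rule inj_on_inverseI[where g = ?f]) (use fg in simp)
  ultimately have hom: "shift n \<in> hom (free_group {..<n}) (free_group {..<n})"
      "map (map_letter ?g) \<in> hom (free_group {..<n}) (free_group {..<n})"
    using assms unfolding shift_def by (auto intro!: map_letter_hom)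
  have "map_letter ?g (map_letter ?f a) = a" "map_letter ?f (map_letter ?g a) = a"
    if "gen_of a < n" for a
    using that gf fg by (cases a; simp)+
  then have "\<forall>u\<in>?C. map (map_letter ?g) (shift n u) = u"
      "\<forall>u\<in>?C. shift n (map (map_letter ?g) u) = u"
    unfolding shift_def free_group_def map_map comp_def by (auto intro!: map_idI)
  moreover have "shift n ` ?C \<subseteq> ?C" "map (map_letter ?g) ` ?C \<subseteq> ?C"
    using hom unfolding hom_def by blast+
  ultimately have "bij_betw (shift n) ?C ?C"
    by (rule bij_betw_byWitness)
  then show ?thesis
    using hom(1) by (simp add: iso_def)
qed

definition cyclic_presentation :: "nat \<Rightarrow> nat word \<Rightarrow> nat presentation" where
  "cyclic_presentation n w = ({..<n}, {(shift n ^^ i) w | i. i < n})"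

end

theory Submission
  imports Defs "HOL-Number_Theory.Cong"
begin

text \<open>Up to the action of \<open>\<int>/n\<close> the star graph has one edge for every cyclic two-letter subword of \<open>w\<close>,
  joining \<open>x\<^sub>i\<^sup>\<plusminus>\<close> to \<open>x\<^sub>j\<^sup>\<plusminus>\<close> with a fixed displacement \<open>j - i\<close>. As \<open>\<int>/n\<close> is
  abelian, commutators of such steps yield short closed paths: length \<open>4\<close> if \<open>w\<close> changes from
  positive to negative letters at two places; length \<open>6\<close> if there are three steps from
  positive to negative vertices and \<open>w\<close> is positive, or two such steps and \<open>w\<close> is mixed (has
  letters of both signs); length \<open>8\<close> if \<open>w\<close> is mixed of length \<open>3\<close>. This bounds the girth. For a mixed \<open>w\<close> let \<open>u\<close> and \<open>v\<close> be the displacements of the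
  unique edges inside the positive and inside the negative vertices. If the diameter is \<open>3\<close> and the girth
  is \<open>6\<close>, a walk with displacement \<open>u + v\<close> must be matched by a walk of length at most \<open>2\<close>, which
  forces \<open>3u + v = 0\<close>, and by symmetry \<open>3u - v = 0\<close>; if the diameter is \<open>4\<close> and the girth is
  \<open>8\<close>, one obtains \<open>5u + v = 0 = 5u - v\<close> in the same way. In both cases \<open>2v = 0\<close>, a closed path of
  length \<open>2\<close>.\<close>

section \<open>Rotations of reduced words\<close>

lemma rotate_back: "x = rotate (length x - j mod length x) (rotate j x)"
proof (cases "x = []")
  case False
  define k where "k = length x"
  have "k > 0" using False by (simp add: k_def)
  have "(k - j mod k + j) mod k = (k - j mod k + j mod k) mod k"
    by (rule mod_add_right_eq[symmetric])
  also have "\<dots> = 0"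
    using \<open>k > 0\<close> by simp
  finally show ?thesis
    by (simp add: rotate_rotate k_def)
qed simp

text \<open>If \<open>y = a @ b\<close>, the rotation \<open>b @ a\<close> is the conjugate of
  \<open>y\<close> by the inverse of \<open>a\<close>. Cyclic reducedness keeps \<open>b @ a\<close>
  reduced, so that concatenation agrees with the group product.\<close>

lemma freely_conjugate_rotate:
  assumes "y \<in> carrier (free_group X)" "cyclically_reduced y"
  shows "freely_conjugate X (rotate j y) y"
proof -
  interpret group "free_group X" by (rule group_free_group)
  define a b where "a = take (j mod length y) y" and "b = drop (j mod length y) y"
  have y: "y = a @ b" and rot: "rotate j y = b @ a"
    by (simp_all add: a_def b_def rotate_drop_take)
  have "reduced (a @ b)" using assms(1) y by (simp add: free_group_def)
  then have "reduced a" "reduced b"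
    by (simp_all add: reduced_def successively_append_iff)
  then have carr: "a \<in> carrier (free_group X)" "b \<in> carrier (free_group X)"
    using assms(1) y by (auto simp: free_group_def)
  have "reduced (b @ a)"
    using cyclically_reduced_rotate[OF assms(2), of j] rot by (simp add: cyclically_reduced_def)
  then have ba: "b @ a = b \<otimes>\<^bsub>free_group X\<^esub> a" and ab: "a @ b = a \<otimes>\<^bsub>free_group X\<^esub> b"
    using \<open>reduced (a @ b)\<close> by (simp_all add: free_group_def reduce_id)
  have "b @ a = inv\<^bsub>free_group X\<^esub> a \<otimes>\<^bsub>free_group X\<^esub> (a @ b) \<otimes>\<^bsub>free_group X\<^esub>
      inv\<^bsub>free_group X\<^esub> (inv\<^bsub>free_group X\<^esub> a)"
    unfolding ba ab using carr by (simp add: m_assoc[symmetric])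
  then have "rotate j y = inv\<^bsub>free_group X\<^esub> a \<otimes>\<^bsub>free_group X\<^esub> y \<otimes>\<^bsub>free_group X\<^esub>
      inv\<^bsub>free_group X\<^esub> (inv\<^bsub>free_group X\<^esub> a)"
    by (simp only: rot y[symmetric])
  then show ?thesis
    unfolding freely_conjugate_def using carr(1) by blast
qed

text \<open>Equality would make a reflection of the cyclic positions send every letter to its
  inverse. Such a reflection fixes a position or swaps two neighbours, so a letter would be its own
  inverse or would cancel against the next one.\<close>

lemma rotate_neq_inv_word:
  assumes "cyclically_reduced x" "x \<noteq> []"
  shows "rotate j x \<noteq> inv_word x"
proof
  define k where "k = length x"
  have k: "k > 0" using assms(2) by (simp add: k_def)
  assume eq: "rotate j x = inv_word x"
  have *: "x ! ((j + t) mod k) = flip (x ! (k - Suc t))" if "t < k" for t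
    using arg_cong[OF eq, of "\<lambda>u. u ! t"] that
    by (simp add: nth_rotate k_def inv_word_def rev_nth)
  have cyc: "x ! (Suc t mod k) \<noteq> flip (x ! t)" if "t < k" for t
  proof (cases "Suc t = k")
    case True
    then have "t = length x - 1" by (simp add: k_def)
    then have "x ! t = last x" "x ! (Suc t mod k) = hd x"
      using assms(2) True k by (simp_all add: hd_conv_nth last_conv_nth)
    then show ?thesis
      using assms by (simp add: cyclically_reduced_def)
  next
    case False
    then have "Suc t < length x" using that by (simp add: k_def)
    then show ?thesis
      using assms
      by (auto simp: cyclically_reduced_def reduced_def k_def successively_conv_nth)
  qed
  define l where "l = j mod k"
  have l: "l < k" using k by (simp add: l_def)
  have *: "x ! ((l + t) mod k) = flip (x ! (k - Suc t))" if "t < k" for t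
    using *[OF that] by (simp add: l_def mod_add_left_eq)
  show False
  \<comment> \<open>The reflection pairs the positions \<open>l + t\<close> and
    \<open>k - 1 - t\<close>; they are neighbours at \<open>t = s - 1\<close> in the even case and
    coincide at \<open>t = s\<close> in the odd one.\<close>
  proof (cases "even (k - l)")
    case True
    then obtain s where s: "k - l = 2 * s" by blast
    then have "k - s < k" "s \<ge> 1" "s \<le> k"  "l + (s - 1) = k - Suc s"
      using l by auto
    then have "x ! (k - Suc s) = flip (x ! (k - s))"
      using *[of "s - 1"] by simp
    moreover have "Suc (k - Suc s) = k - s" using \<open>k - s < k\<close> \<open>s \<ge> 1\<close> \<open>s \<le> k\<close> l \<open>l + (s - 1) = k - Suc s\<close> s
      by linarith
    ultimately show False
      using cyc[of "k - Suc s"] \<open>k - s < k\<close> by simp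
  next
    case False
    then obtain s where s: "k - l = 2 * s + 1" by (metis oddE)
    then have "s < k" "l + s = k - Suc s" using l by auto
    then show False
      using *[of s] by simp
  qed
qed

text \<open>Two equal rotations split \<open>w\<close> as \<open>a @ b = b @ a\<close> with nonempty
  parts, and commuting words are powers of a common word.\<close>

lemma rotate_eq_imp_proper_power:
  assumes "w \<in> carrier (free_group X)" "rotate i w = rotate j w" "i < length w" "j < length w" "i < j"
  shows "proper_power X w"
proof -
  define l where "l = j - i"
  have "w = rotate (length w - i mod length w) (rotate j w)"
    using rotate_back[of w i] assms(2) by simp
  also have "\<dots> = rotate (length w + l) w"
    using assms by (simp add: rotate_rotate l_def)
  also have "\<dots> = rotate l w"
    by (metis mod_add_self1 rotate_conv_mod)
  finally have "w = rotate l w" .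
  define a b where "a = take l w" and "b = drop l w"
  have w: "w = a @ b" by (simp add: a_def b_def)
  have "l < length w" "l > 0" using assms by (auto simp: l_def)
  then have "a \<noteq> []" "b \<noteq> []" by (auto simp: a_def b_def)
  moreover have "a @ b = b @ a"
    using \<open>w = rotate l w\<close> \<open>l < length w\<close> by (simp add: a_def b_def rotate_drop_take)
  ultimately obtain t v where t: "t > 1" "concat (replicate t v) = w"
    using comm_append_is_replicate[of a b] w by blast
  interpret group "free_group X" by (rule group_free_group)
  have "v [^]\<^bsub>free_group X\<^esub> s = reduce (concat (replicate s v))" for s :: nat
  proof (induction s)
    case 0
    then show ?case by (simp add: free_group_def reduce_def)
  next
    case (Suc s)
    have "replicate (Suc s) v = replicate s v @ [v]"
      by (simp add: replicate_append_same)
    then show ?case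
      using Suc by (simp add: free_group_def reduce_reduce_append del: replicate_Suc)
  qed
  moreover have "reduce w = w" using assms(1) by (simp add: free_group_def reduce_id)
  moreover obtain t' where "t = Suc t'" using t by (cases t) auto
  then have "w = v @ concat (replicate t' v)" using t by simp
  then have "v \<in> carrier (free_group X)"
    using assms(1) by (auto simp: free_group_def reduced_def successively_append_iff)
  ultimately show ?thesis
    using t unfolding proper_power_def by (intro bexI[of _ v] exI[of _ t]) auto
qed

lemma shift_funpow:
  assumes "gen_of ` set u \<subseteq> {..<n}"
  shows "(shift n ^^ i) u = map (map_letter (\<lambda>a. (a + i) mod n)) u"
proof (induction i)
  case 0
  have "map_letter (\<lambda>a. a mod n) a = a" if "a \<in> set u" for a
  proof -
    have "gen_of a < n" using that assms by auto
    then show ?thesis by (cases a) auto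
  qed
  then show ?case by (simp add: map_idI)
next
  case (Suc i)
  have "map_letter f (map_letter g a) = map_letter (f \<circ> g) a" for f g :: "nat \<Rightarrow> nat" and a
    by (cases a) auto
  then show ?case
    unfolding funpow.simps comp_apply Suc by (simp add: shift_def comp_def mod_Suc_eq)
qed

section \<open>Arcs of the star graph as steps\<close>

text \<open>A step \<open>(j, True)\<close> stands for an edge of the star graph contributed by the two-letter subword
  of \<open>w\<close> at the cyclic position \<open>j\<close>, and \<open>(j, False)\<close> for the same edge traversed backwards.\<close>

type_synonym step = "nat \<times> bool"

definition op_step :: "step \<Rightarrow> step" where
  "op_step p = (fst p, \<not> snd p)"

lemma op_step_simps [simp]:
  "op_step (op_step p) = p" "op_step p \<noteq> p" "p \<noteq> op_step p"
  "fst (op_step p) = fst p" "snd (op_step p) = (\<not> snd p)"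
  by (auto simp: op_step_def prod_eq_iff)

lemma rev_arc_rev_arc [simp]: "rev_arc (rev_arc r) = r"
  by (cases r rule: rev_arc.cases) simp_all

section \<open>The relators, their rotations and the inverses of these\<close>

locale cyclic_relator =
  fixes n :: nat and w :: "nat word"
  assumes n_pos: "n \<ge> 1"
    and w_carrier: "w \<in> carrier (free_group {..<n})"
    and w_cyclically_reduced: "cyclically_reduced w"
    and w_length: "length w \<ge> 2"
    and not_redundant: "\<not> redundant (cyclic_presentation n w)"
    and not_proper_power: "\<not> proper_power {..<n} w"
begin

definition k :: nat where "k = length w"

abbreviation R :: "nat word set" where "R \<equiv> {(shift n ^^ i) w | i. i < n}"

abbreviation G :: "(nat letter, nat word) pre_digraph" where
  "G \<equiv> star_graph (cyclic_presentation n w)"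

definition th :: "nat \<Rightarrow> nat word" where
  "th i = map (map_letter (\<lambda>a. (a + i) mod n)) w"

lemma k_ge: "k \<ge> 2" and k_pos: "k > 0"
  using w_length by (auto simp: k_def)

lemma w_gens: "gen_of ` set w \<subseteq> {..<n}"
  using w_carrier by (simp add: free_group_def)

lemma R_conv: "R = th ` {..<n}"
  by (auto simp: th_def shift_funpow[OF w_gens])

lemma length_th [simp]: "length (th i) = k"
  by (simp add: th_def k_def)

lemma th_gens: "gen_of ` set (th i) \<subseteq> {..<n}"
  using n_pos by (auto simp: th_def)

lemma add_mod_eq_imp_eq:
  assumes "a < n" "b < n" "(a + i) mod n = (b + i) mod n"
  shows "a = b"
proof -
  have "[a + i = b + i] (mod n)" using assms by (simp add: cong_def)
  then have "[a = b] (mod n)" by (simp add: cong_add_rcancel_nat)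
  then show ?thesis using assms by (simp add: cong_def)
qed

lemma inj_th_letter: "inj_on (map_letter (\<lambda>a. (a + i) mod n)) (set w)"
proof (rule inj_onI)
  fix a b assume ab: "a \<in> set w" "b \<in> set w"
    and eq: "map_letter (\<lambda>a. (a + i) mod n) a = map_letter (\<lambda>a. (a + i) mod n) b"
  have "gen_of a < n" "gen_of b < n" using ab w_gens by auto
  with eq show "a = b"
    using add_mod_eq_imp_eq[of "gen_of a" "gen_of b" i] add_mod_eq_imp_eq[of "gen_of b" "gen_of a" i] by (cases a; cases b) auto
qed

lemma th_carrier: "th i \<in> carrier (free_group {..<n})"
  and th_cyclically_reduced: "cyclically_reduced (th i)"
proof -
  have eq: "map_letter (\<lambda>a. (a + i) mod n) b = flip (map_letter (\<lambda>a. (a + i) mod n) a) \<longleftrightarrow> b = flip a"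
    if "a \<in> set w" "b \<in> set w" for a b
  proof -
    have "gen_of a < n" "gen_of b < n" using that w_gens by auto
    then show ?thesis
      using add_mod_eq_imp_eq[of "gen_of a" "gen_of b" i] add_mod_eq_imp_eq[of "gen_of b" "gen_of a" i] by (cases a; cases b) auto
  qed
  have "successively (\<lambda>a b. map_letter (\<lambda>a. (a + i) mod n) b \<noteq> flip (map_letter (\<lambda>a. (a + i) mod n) a)) w
      \<longleftrightarrow> successively (\<lambda>a b. b \<noteq> flip a) w"
    by (rule successively_cong) (simp_all add: eq)
  then have red: "reduced (th i)"
    using w_cyclically_reduced
    by (simp add: cyclically_reduced_def reduced_def th_def successively_map)
  then show "th i \<in> carrier (free_group {..<n})"
    using th_gens by (simp add: free_group_def)
  have "w \<noteq> []" using w_length by auto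
  then show "cyclically_reduced (th i)"
    using w_cyclically_reduced red eq[of "last w" "hd w"]
    by (auto simp: cyclically_reduced_def th_def hd_map last_map)
qed

lemma th_neq: "i < n \<Longrightarrow> i' < n \<Longrightarrow> i \<noteq> i' \<Longrightarrow> th i \<noteq> th i'"
proof
  assume i: "i < n" "i' < n" "i \<noteq> i'" and "th i = th i'"
  then have "gen_of (th i ! 0) = gen_of (th i' ! 0)" by simp
  then have "(i + gen_of (w ! 0)) mod n = (i' + gen_of (w ! 0)) mod n"
    using k_pos by (simp add: th_def k_def add.commute)
  then show False
    using add_mod_eq_imp_eq i by blast
qed

text \<open>This is the point at which non-redundancy enters.\<close>

lemma th_freely_conjugate:
  assumes "i < n" "i' < n" "freely_conjugate {..<n} (th i) (th i') \<or>
    freely_conjugate {..<n} (th i) (inv_word (th i'))"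
  shows "i = i'"
proof (rule ccontr)
  assume "i \<noteq> i'"
  then have "th i \<noteq> th i'" using th_neq assms by blast
  then have "freely_redundant ({..<n}, R) (th i)"
    using assms th_carrier[of i'] unfolding freely_redundant_def R_conv
    by (auto simp: inv_free_group)
  then show False
    using not_redundant unfolding redundant_def cyclic_presentation_def by blast
qed

text \<open>The word of an arc determines its position in \<open>w\<close>: equal rotations make the
  relators conjugate, hence equal by non-redundancy, and then \<open>w\<close> has two equal
  rotations, which is impossible unless it is a proper power.\<close>

lemma rotate_th_eq:
  assumes "rotate j (th i) = rotate j' (th i')" "i < n" "i' < n" "j < k" "j' < k"
  shows "j = j'"
proof -
  have "th i = rotate (length (th i) - j mod length (th i)) (rotate j (th i))"
    by (rule rotate_back)
  then obtain l where "th i = rotate l (th i')"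
    by (simp add: assms(1) rotate_rotate)
  then have "freely_conjugate {..<n} (th i) (th i')"
    using freely_conjugate_rotate[OF th_carrier th_cyclically_reduced] by metis
  then have "i = i'" using th_freely_conjugate assms by blast
  then have "rotate j w = rotate j' w"
    using assms(1) inj_th_letter[of i]
    by (simp add: th_def rotate_map inj_on_map_eq_map)
  then show ?thesis
    using rotate_eq_imp_proper_power[OF w_carrier] not_proper_power assms
    by (metis k_def nat_neq_iff)
qed

text \<open>Non-redundancy reduces the claim to a single relator, where a rotation would equal the
  inverse.\<close>

lemma rotate_th_neq_inv:
  assumes "i < n" "i' < n"
  shows "rotate j (th i) \<noteq> rotate j' (inv_word (th i'))"
proof
  assume eq: "rotate j (th i) = rotate j' (inv_word (th i'))"
  have "th i = rotate (length (th i) - j mod length (th i)) (rotate j (th i))"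
    by (rule rotate_back)
  then obtain l where l: "th i = rotate l (inv_word (th i'))"
    by (simp add: eq rotate_rotate)
  have "inv_word (th i') \<in> carrier (free_group {..<n})"
    using th_carrier[of i'] by (simp add: free_group_def)
  then have "freely_conjugate {..<n} (th i) (inv_word (th i'))"
    using freely_conjugate_rotate cyclically_reduced_inv_word[OF th_cyclically_reduced] l by metis
  then have "i = i'" using th_freely_conjugate assms by blast
  then have "inv_word (th i) = rotate (length (inv_word (th i)) - l mod length (inv_word (th i))) (th i)"
    using l rotate_back[of "inv_word (th i)" l] by simp
  moreover have "th i \<noteq> []" using k_pos by (metis length_th list.size(3) less_irrefl)
  ultimately show False
    using rotate_neq_inv_word[OF th_cyclically_reduced, of i] by metis
qed

section \<open>Signs and indices as coordinates for vertices and arcs\<close>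

definition nx :: "nat \<Rightarrow> nat" where "nx j = Suc j mod k"

definition sg :: "nat \<Rightarrow> bool" where "sg j = is_pos (w ! j)"

definition gn :: "nat \<Rightarrow> int" where "gn j = int (gen_of (w ! j))"

text \<open>\<open>True\<close> stands for a positive vertex. The arc of a word
  \<open>x y^-1 u\<close> ends at the inverse of its second letter, hence the negated sign of the
  next letter here and in \<open>tgt\<close>.\<close>

definition src :: "step \<Rightarrow> bool" where
  "src p = (if snd p then sg (fst p) else \<not> sg (nx (fst p)))"

definition tgt :: "step \<Rightarrow> bool" where
  "tgt p = (if snd p then \<not> sg (nx (fst p)) else sg (fst p))"

text \<open>Displacements are plain integers, not residues: they add up along a walk, and only
  divisibility by \<open>n\<close> is tested in the end.\<close>

definition disp :: "step \<Rightarrow> int" where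
  "disp p = (if snd p then gn (nx (fst p)) - gn (fst p) else gn (fst p) - gn (nx (fst p)))"

definition vx :: "bool \<Rightarrow> int \<Rightarrow> nat letter" where
  "vx b z = (if b then Pos else Neg) (nat (z mod int n))"

text \<open>The relator is shifted by \<open>z - gn j\<close> so that its letter at position
  \<open>j\<close> gets index \<open>z\<close>; the arc thus starts at index
  \<open>z\<close>.\<close>

definition fwd_arc :: "nat \<Rightarrow> int \<Rightarrow> nat word" where
  "fwd_arc j z = rotate j (th (nat ((z - gn j) mod int n)))"

text \<open>The index \<open>z\<close> always belongs to the tail. A backward step reverses the
  forward arc that ends at \<open>z\<close>, and this arc starts at
  \<open>z + disp p\<close>.\<close>

definition step_arc :: "step \<Rightarrow> int \<Rightarrow> nat word" where
  "step_arc p z = (if snd p then fwd_arc (fst p) z else rev_arc (fwd_arc (fst p) (z + disp p)))"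

definition steps :: "step set" where "steps = {p. fst p < k}"

lemma op_steps [simp]:
  "op_step p \<in> steps \<longleftrightarrow> p \<in> steps" "src (op_step p) = tgt p" "tgt (op_step p) = src p"
  "disp (op_step p) = - disp p"
  by (auto simp: steps_def src_def tgt_def disp_def)

lemma nx_less [simp]: "nx j < k"
  using k_pos by (simp add: nx_def)

lemma index_less [simp]: "nat (z mod int n) < n"
  using n_pos by (simp add: nat_less_iff)

lemma fwd_arc_simps:
  assumes "j < k"
  shows "length (fwd_arc j z) = k"
    and "fwd_arc j z ! 0 = vx (sg j) z"
    and "flip (fwd_arc j z ! 1) = vx (\<not> sg (nx j)) (z + gn (nx j) - gn j)"
proof -
  show "length (fwd_arc j z) = k" by (simp add: fwd_arc_def)
  have *: "map_letter (\<lambda>a. (a + nat ((z - gn j) mod int n)) mod n) (w ! l) =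
      (if sg l then Pos else Neg) (nat ((z + gn l - gn j) mod int n))" for l
  proof -
    have "int ((gen_of (w ! l) + nat ((z - gn j) mod int n)) mod n) = (gn l + (z - gn j)) mod int n"
      using n_pos by (simp add: gn_def zmod_int mod_add_right_eq)
    then have "(gen_of (w ! l) + nat ((z - gn j) mod int n)) mod n = nat ((z + gn l - gn j) mod int n)"
      by (simp add: algebra_simps nat_eq_iff)
    then show ?thesis
      by (cases "w ! l") (simp_all add: sg_def)
  qed
  show "fwd_arc j z ! 0 = vx (sg j) z"
    using assms k_ge *[of j]
    by (simp add: fwd_arc_def nth_rotate th_def k_def[symmetric] vx_def)
  have "(j + 1) mod k = nx j" by (simp add: nx_def)
  then show "flip (fwd_arc j z ! 1) = vx (\<not> sg (nx j)) (z + gn (nx j) - gn j)"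
    using assms k_ge *[of "nx j"] nx_less[of j]
    by (simp add: fwd_arc_def nth_rotate th_def k_def[symmetric] vx_def)
qed

lemma R_carrier: "R \<subseteq> carrier (free_group {..<n})"
  and R_cyclically_reduced: "r \<in> R \<Longrightarrow> cyclically_reduced r"
  unfolding R_conv using th_carrier th_cyclically_reduced by auto

lemma arcs_G: "arcs G = symmetrized_closure R"
proof -
  have "length r = k" if "r \<in> symmetrized_closure R" for r
    using that unfolding symmetrized_closure_def R_conv by auto
  then show ?thesis
    using k_ge by (auto simp: star_graph_def cyclic_presentation_def)
qed

lemma G_simps: "verts G = Pos ` {..<n} \<union> Neg ` {..<n}" "tail G r = r ! 0" "head G r = flip (r ! 1)"
  by (simp_all add: star_graph_def cyclic_presentation_def)

lemma vx_verts [simp]: "vx b z \<in> verts G"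
  by (simp add: G_simps vx_def)

lemma fwd_arc_in: "fwd_arc j z \<in> symmetrized_closure R"
proof -
  have "th (nat ((z - gn j) mod int n)) \<in> th ` {..<n}" by simp
  then show ?thesis
    unfolding symmetrized_closure_def R_conv fwd_arc_def by blast
qed

lemma rev_arc_in:
  assumes "r \<in> symmetrized_closure R" "length r \<ge> 2"
  shows "rev_arc r \<in> symmetrized_closure R"
  using symmetrized_closure_inv_word assms by (simp add: rev_arc_eq_rotate)

lemma rev_arc_ends:
  assumes "length r \<ge> 2"
  shows "rev_arc r ! 0 = flip (r ! 1)" "flip (rev_arc r ! 1) = r ! 0"
  using assms by (cases r rule: rev_arc.cases; simp)+

lemma step_arc_in_arcs [simp]: "p \<in> steps \<Longrightarrow> step_arc p z \<in> arcs G"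
  using k_ge by (auto simp: arcs_G step_arc_def steps_def fwd_arc_in rev_arc_in fwd_arc_simps)

lemma tail_step_arc [simp]: "p \<in> steps \<Longrightarrow> tail G (step_arc p z) = vx (src p) z"
  and head_step_arc [simp]: "p \<in> steps \<Longrightarrow> head G (step_arc p z) = vx (tgt p) (z + disp p)"
  using k_ge
  by (auto simp: G_simps step_arc_def steps_def rev_arc_ends fwd_arc_simps src_def tgt_def disp_def
      algebra_simps simp del: One_nat_def)

lemma vx_eq_iff: "vx b z = vx c y \<longleftrightarrow> b = c \<and> z mod int n = y mod int n"
  using n_pos by (auto simp: vx_def nat_eq_iff)

lemma step_arc_mod:
  assumes "z mod int n = y mod int n"
  shows "step_arc p z = step_arc p y"
proof -
  have "(z + a) mod int n = (y + a) mod int n" for a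
    using assms by (metis mod_add_left_eq)
  from this[of "- gn (fst p)"] this[of "disp p - gn (fst p)"] show ?thesis
    by (simp add: step_arc_def fwd_arc_def algebra_simps)
qed

lemma fwd_arc_neq_rev_arc:
  assumes "j < k" "j' < k"
  shows "fwd_arc j z \<noteq> rev_arc (fwd_arc j' y)"
proof -
  obtain i where "i < n" and i: "fwd_arc j' y = rotate j' (th i)"
    by (metis fwd_arc_def index_less)
  obtain l where "inv_word (rotate j' (th i)) = rotate l (inv_word (th i))"
    using inv_word_rotate by blast
  then have "rev_arc (fwd_arc j' y) = rotate (k - 2 + l) (inv_word (th i))"
    using k_ge i by (simp add: rev_arc_eq_rotate rotate_rotate)
  then show ?thesis
    using rotate_th_neq_inv[OF _ \<open>i < n\<close>] by (simp add: fwd_arc_def)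
qed

text \<open>Backtracking of arcs forces backtracking of steps, so the absence of backtracking can be
  checked on the steps alone.\<close>

lemma step_arc_eq_rev_arc:
  assumes "step_arc p z = rev_arc (step_arc q y)" "p \<in> steps" "q \<in> steps"
  shows "p = op_step q"
proof -
  have j: "fst p < k" "fst q < k" using assms by (auto simp: steps_def)
  have eq: "j = j'" if "fwd_arc j z = fwd_arc j' y" "j < k" "j' < k" for j j' z y
    using rotate_th_eq that by (simp add: fwd_arc_def)
  have rev: "rev_arc a = rev_arc b \<longleftrightarrow> a = b" for a b :: "nat word"
    by (metis rev_arc_rev_arc)
  consider "snd p" "snd q" | "snd p" "\<not> snd q" | "\<not> snd p" "snd q" | "\<not> snd p" "\<not> snd q"
    by blast
  then show ?thesis
  proof cases
    case 1
    then show ?thesis using assms(1) j fwd_arc_neq_rev_arc by (simp add: step_arc_def)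
  next
    case 2
    then have "fwd_arc (fst p) z = fwd_arc (fst q) (y + disp q)"
      using assms(1) by (simp add: step_arc_def)
    then show ?thesis using eq j 2 by (simp add: prod_eq_iff)
  next
    case 3
    then have "fwd_arc (fst p) (z + disp p) = fwd_arc (fst q) y"
      using assms(1) by (simp add: step_arc_def rev)
    then show ?thesis using eq j 3 by (simp add: prod_eq_iff)
  next
    case 4
    then have "fwd_arc (fst q) (y + disp q) = rev_arc (fwd_arc (fst p) (z + disp p))"
      using assms(1) by (simp add: step_arc_def)
    then show ?thesis using j fwd_arc_neq_rev_arc by simp
  qed
qed

lemma step_arc_exhaust:
  assumes "r \<in> arcs G"
  obtains p z where "p \<in> steps" "r = step_arc p z"
proof -
  have *: "\<exists>j<k. \<exists>z. rotate l (th i) = fwd_arc j z" if "i < n" for i l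
  proof (intro exI conjI)
    \<comment> \<open>The second argument is chosen so that the shift inside \<open>fwd_arc\<close>
      becomes \<open>i\<close>.\<close>
    show "rotate l (th i) = fwd_arc (l mod k) (gn (l mod k) + int i)"
      using that by (simp add: fwd_arc_def rotate_conv_mod[of l])
  qed (use k_pos in simp)
  obtain l i where "i < n" and r: "r = rotate l (th i) \<or> r = rotate l (inv_word (th i))"
    using assms unfolding arcs_G symmetrized_closure_def R_conv by auto
  from r show ?thesis
  proof
    assume "r = rotate l (th i)"
    then obtain j z where "j < k" "r = fwd_arc j z" using * \<open>i < n\<close> by blast
    then show ?thesis by (intro that[of "(j, True)" z]) (simp_all add: steps_def step_arc_def)
  next
    assume r: "r = rotate l (inv_word (th i))"
    obtain l' where "inv_word r = rotate l' (th i)"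
      using inv_word_rotate[of l "inv_word (th i)"] r by auto
    then have "rev_arc r = rotate (k - 2 + l') (th i)"
      using r k_ge by (simp add: rev_arc_eq_rotate rotate_rotate)
    then obtain j z where "j < k" "rev_arc r = fwd_arc j z" using * \<open>i < n\<close> by metis
    then have "r = rev_arc (fwd_arc j z)" by (metis rev_arc_rev_arc)
    with \<open>j < k\<close> show ?thesis
      by (intro that[of "(j, False)" "z - disp (j, False)"]) (simp_all add: steps_def step_arc_def)
  qed
qed

end

section \<open>Closed step lists and components\<close>

text \<open>All vertices of a walk are reachable from its start, and in a symmetric graph this keeps
  them in the same component.\<close>

lemma (in sym_digraph) awalk_induce_scc_of:
  assumes "awalk u p v"
  shows "pre_digraph.awalk (G \<restriction> scc_of u) u p v"
proof (rule awalk_induce[OF assms])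
  show "set (awalk_verts u p) \<subseteq> scc_of u"
    using awalk_verts_reachable_from[OF assms] scc_ofI_reachable' by auto
qed

lemma (in wf_digraph) awalk_of_induce:
  assumes "pre_digraph.awalk (G \<restriction> S) u p v" "S \<subseteq> verts G"
  shows "awalk u p v"
  using subgraph_awalk_imp_awalk[OF assms(1)] induced_induce[OF assms(2)]
  by (auto simp: induced_subgraph_def)

lemma (in wf_digraph) awalk_parity:
  assumes "awalk u p v" "A \<inter> B = {}"
    "\<forall>e\<in>arcs G. tail G e \<in> A \<and> head G e \<in> B \<or> tail G e \<in> B \<and> head G e \<in> A"
    "verts G = A \<union> B"
  shows "v \<in> A \<longleftrightarrow> (u \<in> A \<longleftrightarrow> even (length p))"
  using assms(1)
proof (induction p arbitrary: u)
  case Nil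
  then show ?case by (auto simp: awalk_Nil_iff)
next
  case (Cons e p)
  then show ?case
    using assms(2) bspec[OF assms(3), of e] by (auto simp: awalk_Cons_iff)
qed

lemma graph_dist_leD:
  assumes "graph_dist G u v \<le> enat m"
  shows "\<exists>p. pre_digraph.awalk G u p v \<and> length p \<le> m"
proof (rule ccontr)
  assume no: "\<not> (\<exists>p. pre_digraph.awalk G u p v \<and> length p \<le> m)"
  then have "enat (Suc m) \<le> enat (length p)" if "pre_digraph.awalk G u p v" for p
    using no that by (auto simp: not_le Suc_le_eq)
  then have "enat (Suc m) \<le> graph_dist G u v"
    unfolding graph_dist_def by (auto intro!: INF_greatest)
  with assms have "enat (Suc m) \<le> enat m" by (rule order_trans[rotated])
  then show False by simp
qed

lemma rotate1_rev_arc_ends: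
  assumes "length r \<ge> 2"
  shows "last (rotate1 (rev_arc r)) = flip (r ! 1)" "hd (rotate1 (rev_arc r)) = flip (r ! 0)"
    and "rotate1 (rev_arc r) \<noteq> []"
  using assms by (cases r rule: rev_arc.cases; simp)+

context cyclic_relator
begin

lemma sym_digraph_G: "sym_digraph G"
proof -
  interpret bidirected_digraph G "\<lambda>r. if r \<in> arcs G then rev_arc r else r"
    using bidirected_star_graph(1)[OF R_carrier R_cyclically_reduced]
    by (simp add: cyclic_presentation_def)
  show ?thesis by unfold_locales
qed

interpretation SG: sym_digraph G
  by (rule sym_digraph_G)

text \<open>Only the signs of the vertices are followed; their indices are recovered from the
  starting index and the displacements.\<close>

primrec chain :: "bool \<Rightarrow> step list \<Rightarrow> bool \<Rightarrow> bool" where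
  "chain b [] c \<longleftrightarrow> b = c"
| "chain b (p # ps) c \<longleftrightarrow> p \<in> steps \<and> src p = b \<and> chain (tgt p) ps c"

abbreviation total :: "step list \<Rightarrow> int" where
  "total ps \<equiv> sum_list (map disp ps)"

definition closed_steps :: "step list \<Rightarrow> bool" where
  "closed_steps ps \<longleftrightarrow> ps \<noteq> [] \<and> (\<exists>b. chain b ps b) \<and> int n dvd total ps \<and>
     (\<forall>i<length ps. ps ! (Suc i mod length ps) \<noteq> op_step (ps ! i))"

primrec warcs :: "int \<Rightarrow> step list \<Rightarrow> nat word list" where
  "warcs z [] = []"
| "warcs z (p # ps) = step_arc p z # warcs (z + disp p) ps"

lemma length_warcs [simp]: "length (warcs z ps) = length ps"
  by (induction ps arbitrary: z) auto

lemma awalk_warcs: "chain b ps c \<Longrightarrow> SG.awalk (vx b z) (warcs z ps) (vx c (z + total ps))"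
proof (induction ps arbitrary: b z)
  case Nil
  then show ?case by (simp add: SG.awalk_Nil_iff)
next
  case (Cons p ps)
  then have "p \<in> steps" "src p = b" "chain (tgt p) ps c" by auto
  then show ?case
    using Cons.IH[of "tgt p" "z + disp p"] by (simp add: SG.awalk_Cons_iff add.assoc)
qed

text \<open>Converse of \<open>awalk_warcs\<close>: every arc is a step arc, and by periodicity its
  index can be replaced by the current one.\<close>

lemma awalk_imp_chain:
  assumes "SG.awalk (vx b z) r v"
  shows "\<exists>ps c. chain b ps c \<and> length ps = length r \<and> v = vx c (z + total ps)"
  using assms
proof (induction r arbitrary: b z)
  case Nil
  then show ?case by (intro exI[of _ "[]"] exI[of _ b]) (auto simp: SG.awalk_Nil_iff)
next
  case (Cons e r)
  then have e: "e \<in> arcs G" "tail G e = vx b z" and r: "SG.awalk (head G e) r v"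
    by (auto simp: SG.awalk_Cons_iff)
  obtain p y where p: "p \<in> steps" "e = step_arc p y" by (rule step_arc_exhaust[OF e(1)])
  then have y: "src p = b" "y mod int n = z mod int n"
    using e(2) by (simp_all add: vx_eq_iff)
  have "e = step_arc p z" using p step_arc_mod[OF y(2)] by simp
  then have "head G e = vx (tgt p) (z + disp p)" using p by simp
  then obtain ps c where "chain (tgt p) ps c" "length ps = length r"
      "v = vx c (z + disp p + total ps)"
    using Cons.IH r by metis
  then show ?case
    using p y by (intro exI[of _ "p # ps"] exI[of _ c]) (simp add: add.assoc)
qed

lemma nth_warcs: "i < length ps \<Longrightarrow> warcs z ps ! i = step_arc (ps ! i) (z + total (take i ps))"
proof (induction ps arbitrary: z i)
  case (Cons p ps)
  then show ?case by (cases i) (simp_all add: add.assoc)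
qed simp

lemma chain_nth:
  assumes "chain b ps c" "i < length ps"
  shows "ps ! i \<in> steps" and "tgt (ps ! i) = (if Suc i < length ps then src (ps ! Suc i) else c)"
    and "src (ps ! 0) = b"
  using assms
proof (induction ps arbitrary: b i)
  case (Cons p ps)
  { case 1 then show ?case using Cons.IH(1)[of "tgt p"] by (cases i) auto }
  { case 2 then show ?case
      using Cons.IH(2)[of "tgt p"] by (cases i; cases ps) auto }
  { case 3 then show ?case by simp }
qed simp_all

lemma closed_steps_arcs:
  assumes "closed_steps ps" "i < length ps"
  defines "r \<equiv> warcs 0 ps" and "i' \<equiv> Suc i mod length ps"
  shows "r ! i \<in> arcs G" "r ! i' \<noteq> rev_arc (r ! i)" "tail G (r ! i') = head G (r ! i)"
proof -
  obtain b where b: "chain b ps b" using assms by (auto simp: closed_steps_def)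
  have i': "i' < length ps" using assms(2) unfolding i'_def by (cases ps) auto
  have mem: "ps ! j \<in> steps" if "j < length ps" for j
    using chain_nth(1)[OF b that] .
  have ri: "r ! i = step_arc (ps ! i) (total (take i ps))"
    using assms(2) by (simp add: r_def nth_warcs)
  have "r ! i' = step_arc (ps ! i') (total (take i' ps))"
    using i' by (simp add: r_def nth_warcs)
  also have "\<dots> = step_arc (ps ! i') (total (take (Suc i) ps))"
  proof (cases "Suc i < length ps")
    \<comment> \<open>At the wrap-around \<open>i'\<close> is 0, and the whole displacement is a
      multiple of \<open>n\<close>, so the index has returned to its starting class.\<close>
    case False
    then have "Suc i = length ps" using assms(2) by simp
    then show ?thesis
      using assms(1) by (intro step_arc_mod) (simp add: i'_def closed_steps_def mod_eq_0_iff_dvd)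
  qed (simp add: i'_def)
  finally have ri': "r ! i' = step_arc (ps ! i') (total (take i ps) + disp (ps ! i))"
    using assms(2) by (simp add: take_Suc_conv_app_nth)
  show "r ! i \<in> arcs G" using ri mem assms(2) by simp
  have "ps ! i' \<noteq> op_step (ps ! i)"
    using assms(1,2) by (simp add: closed_steps_def i'_def)
  then show "r ! i' \<noteq> rev_arc (r ! i)"
    using step_arc_eq_rev_arc mem i' assms(2) unfolding ri ri' by blast
  have "src (ps ! i') = tgt (ps ! i)"
    using chain_nth(2)[OF b assms(2)] chain_nth(3)[OF b assms(2)] assms(2)
    by (cases "Suc i = length ps") (simp_all add: i'_def)
  then show "tail G (r ! i') = head G (r ! i)"
    using ri ri' mem i' assms(2) by simp
qed

text \<open>A closed path without backtracking violates the cancellation condition at its length.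
  The arc \<open>x y^-1 u\<close> is turned into the word \<open>x^-1 u^-1 y\<close>; the next arc
  starts at \<open>y\<close>, so its word begins with \<open>y^-1\<close> and every product
  cancels.\<close>

lemma T_condition_closed_steps:
  assumes "T_condition q (cyclic_presentation n w)" "closed_steps ps" "length ps \<ge> 3"
  shows "length ps \<ge> q"
proof (rule ccontr)
  assume "\<not> length ps \<ge> q"
  define h where "h = length ps"
  define e where "e i = warcs 0 ps ! i" for i
  define r where "r i = rotate1 (rev_arc (e i))" for i
  have arcs: "e i \<in> arcs G" "e (Suc i mod h) \<noteq> rev_arc (e i)"
    "tail G (e (Suc i mod h)) = head G (e i)" if "i < h" for i
    using closed_steps_arcs[OF assms(2)] that by (auto simp: e_def h_def)
  have len: "length (e i) \<ge> 2" if "i < h" for i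
    using arcs(1)[OF that] by (simp add: star_graph_def cyclic_presentation_def)
  have r: "r i \<in> symmetrized_closure R" if "i < h" for i
    using symmetrized_closure_inv_word[of "e i" R "Suc (length (e i) - 2)"] arcs(1)[OF that] len[OF that]
    by (simp add: r_def arcs_G rev_arc_eq_rotate)
  \<comment> \<open>Hence consecutive inverse words would, by injectivity of \<open>rotate1\<close>,
    be consecutive mutually reverse arcs.\<close>
  have "inv_word (r i) = rotate1 (e i)" if "i < h" for i
    using len[OF that] by (cases "e i" rule: rev_arc.cases) (simp_all add: r_def inv_word_def rev_map comp_def)
  moreover have h: "Suc i mod h < h" if "i < h" for i using that by (cases h) auto
  ultimately have "r i \<noteq> inv_word (r (Suc i mod h))" if "i < h" for i
    using arcs(2)[OF that] injD[OF inj_rotate1, of "rev_arc (e i)" "e (Suc i mod h)"] that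
    by (auto simp: r_def)
  moreover have "\<not> reduced (r i @ r (Suc i mod h))" if i: "i < h" for i
  proof -
    have "last (r i) = flip (hd (r (Suc i mod h)))"
      using arcs(3)[OF i] rotate1_rev_arc_ends[OF len[OF i]] rotate1_rev_arc_ends[OF len[OF h[OF i]]]
      by (simp add: r_def G_simps)
    moreover have "r i \<noteq> []" "r (Suc i mod h) \<noteq> []"
      using rotate1_rev_arc_ends(3)[OF len[OF i]] rotate1_rev_arc_ends(3)[OF len[OF h[OF i]]]
      by (simp_all add: r_def)
    ultimately show ?thesis by (simp add: reduced_def successively_append_iff)
  qed
  moreover have "3 \<le> h" "h < q" using assms(3) \<open>\<not> length ps \<ge> q\<close> by (auto simp: h_def)
  moreover have "3 \<le> h \<and> h < q \<and> (\<forall>i<h. r i \<in> symmetrized_closure R) \<and>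
      (\<forall>i<h. r i \<noteq> inv_word (r (Suc i mod h))) \<longrightarrow> (\<exists>i<h. reduced (r i @ r (Suc i mod h)))"
    using assms(1) unfolding T_condition_def cyclic_presentation_def prod.case by blast
  ultimately show False
    using r by blast
qed

section \<open>Girth and diameter of a special presentation in terms of step lists\<close>

lemma special_component:
  fixes b :: bool and z :: int
  assumes "special m l \<nu> (cyclic_presentation n w)"
  defines "C \<equiv> G \<restriction> SG.scc_of (vx b z)"
  shows "bipartite C" "diameter C = enat m" "girth rev_arc C = enat (2 * m)"
    and "SG.scc_of (vx b z) \<subseteq> verts G"
proof -
  have "SG.scc_of (vx b z) \<in> SG.sccs_verts"
    by (rule SG.scc_of_in_sccs_verts) simp
  then have "C \<in> SG.sccs"
    unfolding C_def by (rule SG.in_verts_sccsD_sccs)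
  then show "bipartite C" "diameter C = enat m" "girth rev_arc C = enat (2 * m)"
    using assms(1) unfolding special_def by (auto simp: cyclic_presentation_def)
  show "SG.scc_of (vx b z) \<subseteq> verts G"
    using \<open>_ \<in> SG.sccs_verts\<close> by (rule SG.sccs_verts_subsets)
qed

lemma special_closed_steps:
  assumes "special m l \<nu> (cyclic_presentation n w)" "closed_steps ps"
  shows "length ps \<ge> 2 * m"
proof -
  obtain b where b: "chain b ps b" using assms(2) by (auto simp: closed_steps_def)
  have "vx b (0 + total ps) = vx b 0"
    using assms(2) by (simp add: vx_eq_iff closed_steps_def mod_eq_0_iff_dvd)
  then have walk: "SG.awalk (vx b 0) (warcs 0 ps) (vx b 0)"
    using awalk_warcs[OF b, of 0] by metis
  define C where "C = G \<restriction> SG.scc_of (vx b 0)"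
  interpret C: wf_digraph C unfolding C_def by (rule SG.wellformed_induce_subgraph)
  have "C.closed_w (warcs 0 ps)"
    using SG.awalk_induce_scc_of[OF walk, folded C_def] assms(2)
    by (auto simp: C.closed_w_def closed_steps_def)
  then have "girth rev_arc C \<le> enat (length (warcs 0 ps))"
    unfolding girth_def using closed_steps_arcs(2)[OF assms(2)] by (intro INF_lower) auto
  then show ?thesis
    using special_component(3)[OF assms(1), of b 0] by (simp add: C_def)
qed

text \<open>The diameter supplies a walk of length at most \<open>m\<close> with the same ends,
  bipartiteness makes the parities agree, and equal end vertices make the displacements
  congruent.\<close>

lemma special_short_chain:
  assumes "special m l \<nu> (cyclic_presentation n w)" "chain b ps c"
  obtains qs where "chain b qs c" "length qs \<le> m" "even (length qs) = even (length ps)"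
    "int n dvd total ps - total qs"
proof -
  define u v where "u = vx b 0" and "v = vx c (total ps)"
  have walk: "SG.awalk u (warcs 0 ps) v"
    using awalk_warcs[OF assms(2), of 0] by (simp add: u_def v_def)
  define C where "C = G \<restriction> SG.scc_of u"
  interpret C: wf_digraph C unfolding C_def by (rule SG.wellformed_induce_subgraph)
  have walkC: "C.awalk u (warcs 0 ps) v"
    using SG.awalk_induce_scc_of[OF walk] by (simp add: C_def)
  note C = special_component[OF assms(1), of b 0, folded u_def, folded C_def]
  have "u \<in> verts C" "v \<in> verts C"
    using C.awalk_hd_in_verts C.awalk_last_in_verts walkC by auto
  then have "graph_dist C u v \<le> diameter C"
    unfolding diameter_def by (intro SUP_upper2[of "(u, v)"]) simp_all
  then have "graph_dist C u v \<le> enat m" using C(2) by simp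
  then obtain p where p: "C.awalk u p v" "length p \<le> m"
    using graph_dist_leD[of C u v m] by blast
  obtain A B where AB: "A \<inter> B = {}" "verts C = A \<union> B"
    "\<forall>e\<in>arcs C. tail C e \<in> A \<and> head C e \<in> B \<or> tail C e \<in> B \<and> head C e \<in> A"
    using C(1) unfolding bipartite_def by blast
  have "even (length p) = even (length ps)"
    using C.awalk_parity[OF p(1) AB(1,3,2)] C.awalk_parity[OF walkC AB(1,3,2)]
    unfolding length_warcs by blast
  moreover have "SG.awalk u p v"
    using SG.awalk_of_induce p(1) C(4) unfolding C_def by blast
  then obtain qs c' where qs: "chain b qs c'" "length qs = length p" "v = vx c' (0 + total qs)"
    using awalk_imp_chain[of b 0 p v] by (auto simp: u_def)
  moreover have "c = c'" "total ps mod int n = total qs mod int n"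
    using qs(3) unfolding v_def vx_eq_iff by simp_all
  ultimately show ?thesis
    using p(2) by (intro that[of qs]) (simp_all add: mod_eq_dvd_iff)
qed

end

section \<open>Short closed paths\<close>

lemma op_step_eq_iff [simp]: "op_step p = op_step q \<longleftrightarrow> p = q"
  by (auto simp: op_step_def prod_eq_iff)

lemma exists_fresh_index:
  assumes "finite A" "card A < m"
  shows "\<exists>j<m. j \<notin> A"
proof (rule ccontr)
  assume "\<not> (\<exists>j<m. j \<notin> A)"
  then have "{..<m} \<subseteq> A" by auto
  then show False using card_mono[OF assms(1), of "{..<m}"] assms(2) by simp
qed

context cyclic_relator
begin

text \<open>Appending the head turns the cyclic condition into a linear one, which simplification
  decides for explicit lists.\<close>

lemma closed_stepsI:
  assumes "ps \<noteq> []" "chain b ps b" "int n dvd total ps"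
    and "successively (\<lambda>p q. q \<noteq> op_step p) (ps @ [hd ps])"
  shows "closed_steps ps"
  unfolding closed_steps_def
proof (intro conjI allI impI)
  fix i assume i: "i < length ps"
  have "(ps @ [hd ps]) ! Suc i \<noteq> op_step ((ps @ [hd ps]) ! i)"
    using assms(4) i by (auto simp: successively_conv_nth)
  moreover have "(ps @ [hd ps]) ! Suc i = ps ! (Suc i mod length ps)"
    using i assms(1) by (cases "Suc i = length ps") (auto simp: nth_append hd_conv_nth)
  ultimately show "ps ! (Suc i mod length ps) \<noteq> op_step (ps ! i)"
    using i by (simp add: nth_append)
qed (use assms in auto)

text \<open>A commutator: its displacement vanishes identically. It is what forbids a second edge
  inside either sign class.\<close>

lemma closed_steps_two_loops:
  assumes "p \<in> steps" "q \<in> steps" "src p = b" "tgt p = b" "src q = b" "tgt q = b"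
    and "p \<noteq> q" "p \<noteq> op_step q"
  shows "closed_steps [p, q, op_step p, op_step q]"
  using assms by (intro closed_stepsI[of _ b]) auto

section \<open>Closed paths from an edge \<open>U\<close> inside the positive vertices, an edge
  \<open>V\<close> inside the negative ones and a rung \<open>S\<close> between them\<close>

context
  fixes U V S :: step
  assumes U: "U \<in> steps" "src U" "tgt U"
    and V: "V \<in> steps" "\<not> src V" "\<not> tgt V"
    and S: "S \<in> steps" "src S" "\<not> tgt S"
begin

lemma step_kinds_neq:
  "U \<noteq> S" "U \<noteq> op_step S" "V \<noteq> S" "V \<noteq> op_step S" "U \<noteq> V" "U \<noteq> op_step V"
  "S \<noteq> U" "op_step S \<noteq> U" "S \<noteq> V" "op_step S \<noteq> V" "S \<noteq> op_step U" "S \<noteq> op_step V"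
  "op_step U \<noteq> S" "op_step V \<noteq> S"
  using U V S by (metis op_steps)+

lemmas kinds = U V S step_kinds_neq

text \<open>The displacement of \<open>S\<close> cancels. The lemma serves in contrapositive form:
  large girth excludes these divisibilities.\<close>

lemma closed_steps_square:
  "int n dvd disp U + disp V \<Longrightarrow> closed_steps [U, S, V, op_step S]"
  "int n dvd disp U - disp V \<Longrightarrow> closed_steps [U, S, op_step V, op_step S]"
  by (rule closed_stepsI[of _ True]; simp add: kinds)+

lemma closed_steps_hexagon:
  "int n dvd 3 * disp U + disp V \<Longrightarrow> closed_steps [U, U, U, S, V, op_step S]"
  "int n dvd 2 * disp U + 2 * disp V \<Longrightarrow> closed_steps [U, U, S, V, V, op_step S]"
  by (rule closed_stepsI[of _ True]; simp add: kinds algebra_simps)+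

lemma closed_steps_double_loop:
  "int n dvd 2 * disp U \<Longrightarrow> closed_steps [U, U]"
  "int n dvd 2 * disp V \<Longrightarrow> closed_steps [V, V]"
  by (rule closed_stepsI[of _ True], simp_all add: kinds)
    (rule closed_stepsI[of _ False], simp_all add: kinds)

text \<open>The commutator of \<open>U\<close> with the conjugate of \<open>V\<close> by
  \<open>S\<close>, which also starts and ends at positive vertices.\<close>

lemma closed_steps_octagon:
  "closed_steps [U, S, V, op_step S, op_step U, S, op_step V, op_step S]"
  by (rule closed_stepsI[of _ True]) (simp_all add: kinds)

text \<open>The commutator of \<open>U\<close> with the detour along \<open>S\<close> and back along
  \<open>S'\<close>.\<close>

lemma closed_steps_two_rungs:
  assumes "S' \<in> steps" "src S'" "\<not> tgt S'" "S' \<noteq> S"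
  shows "closed_steps [U, S, op_step S', op_step U, S', op_step S]"
proof -
  have "S' \<noteq> U" "S' \<noteq> op_step U" "U \<noteq> S'" "U \<noteq> op_step S'" "op_step S' \<noteq> U"
    using U assms by (metis op_steps)+
  then show ?thesis
    using assms assms(4)[symmetric] by (intro closed_stepsI[of _ True]) (simp_all add: kinds)
qed

text \<open>The step list \<open>[U, S, V, op_step S]\<close> of length \<open>4\<close> must be matched by one of length at
  most \<open>2\<close>, and the girth leaves only \<open>- 2 * disp U\<close> as its displacement.\<close>

lemma special_3_relation:
  assumes sp: "special 3 l \<nu> (cyclic_presentation n w)"
    and uniq: "\<forall>p\<in>steps. src p \<and> tgt p \<longrightarrow> p = U \<or> p = op_step U"
  shows "int n dvd 3 * disp U + disp V"
proof -
  have girth: "length ps \<ge> 6" if "closed_steps ps" for ps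
    using special_closed_steps[OF sp that] by simp
  have no: "\<not> int n dvd disp U + disp V" "\<not> int n dvd disp U - disp V"
    using girth closed_steps_square by fastforce+
  have "chain True [U, S, V, op_step S] True" by (simp add: kinds)
  then obtain qs where qs: "chain True qs True" "length qs \<le> 3" "even (length qs)"
    and dvd: "int n dvd disp U + disp V - total qs"
    by (rule special_short_chain[OF sp]) simp
  have "length qs = 0 \<or> length qs = 2"
    using qs(2,3) by presburger
  then consider "qs = []" | a b where "qs = [a, b]"
    by (auto simp: length_Suc_conv numeral_2_eq_2)
  then show ?thesis
  proof cases
    case 1
    then show ?thesis using dvd no by simp
  next
    case (2 a b)
    then have ab: "a \<in> steps" "src a" "b \<in> steps" "src b = tgt a" "tgt b"
      and dvd: "int n dvd disp U + disp V - disp a - disp b"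
      using qs(1) dvd by (auto simp: algebra_simps)
    show ?thesis
    proof (cases "tgt a")
      \<comment> \<open>The displacement of \<open>qs\<close> is 0 or plus or minus
        \<open>2 * disp U\<close>; the squares exclude 0 and \<open>2 * disp U\<close>.\<close>
      case True
      then have "a = U \<or> a = op_step U" "b = U \<or> b = op_step U"
        using ab uniq by blast+
      then show ?thesis
        using dvd no dvd_diff_commute[of "int n" "disp U" "disp V"]
        by (auto simp: algebra_simps)
    next
      case False
      \<comment> \<open>Here \<open>a\<close> and \<open>b\<close> are themselves a descent and a
        return. They can replace \<open>S\<close> and its reverse around \<open>V\<close>, since
        only the sum of displacements matters, and the path has length 4.\<close>
      have "op_step b \<noteq> op_step U" "V \<noteq> b" "op_step a \<noteq> op_step V" "U \<noteq> a"
        "op_step b \<noteq> U" "b \<noteq> U" "a \<noteq> V" "a \<noteq> U" "V \<noteq> a"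
        using ab U V False by (metis op_steps)+
      then have "closed_steps [U, op_step b, V, op_step a]"
        using dvd ab False
        by (intro closed_stepsI[of _ True]) (simp_all add: kinds algebra_simps)
      then show ?thesis using girth by fastforce
    qed
  qed
qed

text \<open>Here the step list \<open>[U, U, S, V, op_step S]\<close> must be matched by one of length \<open>1\<close> or \<open>3\<close>.\<close>

lemma special_4_relation:
  assumes sp: "special 4 l \<nu> (cyclic_presentation n w)"
    and uniqU: "\<forall>p\<in>steps. src p \<and> tgt p \<longrightarrow> p = U \<or> p = op_step U"
    and uniqV: "\<forall>p\<in>steps. \<not> src p \<and> \<not> tgt p \<longrightarrow> p = V \<or> p = op_step V"
    and uniqS: "\<forall>p\<in>steps. src p \<and> \<not> tgt p \<longrightarrow> p = S"
  shows "int n dvd 5 * disp U + disp V"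
proof -
  have girth: "length ps \<ge> 8" if "closed_steps ps" for ps
    using special_closed_steps[OF sp that] by simp
  have no: "\<not> int n dvd disp U + disp V" "\<not> int n dvd disp V - disp U"
    "\<not> int n dvd 3 * disp U + disp V" "\<not> int n dvd 2 * disp U"
    "\<not> int n dvd 2 * disp U + 2 * disp V"
    using girth[OF closed_steps_square(1)] girth[OF closed_steps_square(2)]
      girth[OF closed_steps_hexagon(1)] girth[OF closed_steps_hexagon(2)]
      girth[OF closed_steps_double_loop(1)] dvd_diff_commute[of "int n" "disp U" "disp V"]
    by auto
  have "chain True [U, U, S, V, op_step S] True" by (simp add: kinds)
  then obtain qs where qs: "chain True qs True" "length qs \<le> 4" "odd (length qs)"
    and dvd: "int n dvd 2 * disp U + disp V - total qs"
    by (rule special_short_chain[OF sp]) (simp add: algebra_simps)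
  have uniqS': "p = op_step S" if "p \<in> steps" "\<not> src p" "tgt p" for p
    using bspec[OF uniqS, of "op_step p"] that by auto
  have "length qs = 1 \<or> length qs = 3"
    using qs(2,3) by presburger
  then consider a where "qs = [a]" | a b c where "qs = [a, b, c]"
    by (auto simp: length_Suc_conv numeral_3_eq_3)
  \<comment> \<open>With a single rung, any excursion to the negative vertices uses \<open>S\<close>
    and its reverse, which cancel. Of the six values, \<open>no\<close> excludes all but
    \<open>- 3 * disp U\<close>, which gives the claim.\<close>
  then have "total qs \<in> {3 * disp U, disp U, - disp U, - 3 * disp U, disp V, - disp V}"
  proof cases
    case (1 a)
    then have "a = U \<or> a = op_step U" using qs(1) uniqU by auto
    then show ?thesis using 1 by auto
  next
    case (2 a b c)
    then have abc: "a \<in> steps" "src a" "b \<in> steps" "src b = tgt a" "c \<in> steps" "src c = tgt b" "tgt c"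
      using qs(1) by auto
    consider "tgt a" "tgt b" | "tgt a" "\<not> tgt b" | "\<not> tgt a" "tgt b" | "\<not> tgt a" "\<not> tgt b"
      by blast
    then show ?thesis
    proof cases
      case 1
      then have "a = U \<or> a = op_step U" "b = U \<or> b = op_step U" "c = U \<or> c = op_step U"
        using abc uniqU by blast+
      then show ?thesis using 2 by auto
    next
      case 2
      then have "a = U \<or> a = op_step U" "b = S" "c = op_step S"
        using abc uniqU uniqS uniqS' by blast+
      then show ?thesis using \<open>qs = [a, b, c]\<close> by auto
    next
      case 3
      then have "a = S" "b = op_step S" "c = U \<or> c = op_step U"
        using abc uniqU uniqS uniqS' by blast+
      then show ?thesis using 2 by auto
    next
      case 4
      then have "a = S" "b = V \<or> b = op_step V" "c = op_step S"
        using abc uniqV uniqS uniqS' by blast+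
      then show ?thesis using 2 by auto
    qed
  qed
  then show ?thesis
    using dvd no by (auto simp: algebra_simps)
qed

end

text \<open>Each rung is traversed once in each direction, so the displacement is 0.\<close>

lemma closed_steps_three_rungs:
  assumes "\<forall>p\<in>{S1, S2, S3}. p \<in> steps \<and> src p \<and> \<not> tgt p"
    and "S1 \<noteq> S2" "S1 \<noteq> S3" "S2 \<noteq> S3"
  shows "closed_steps [S1, op_step S2, S3, op_step S1, S2, op_step S3]"
  using assms assms(2-4)[symmetric] by (intro closed_stepsI[of _ True]) simp_all

section \<open>Sign changes of the cyclic word \<open>w\<close>\<close>

lemma cyclic_index_induct:
  assumes "P j0" "j0 < k" "\<And>j. j < k \<Longrightarrow> P j \<Longrightarrow> P (nx j)" "j < k"
  shows "P j"
proof -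
  have *: "P ((j0 + i) mod k)" for i
  proof (induction i)
    case 0
    then show ?case using assms by simp
  next
    case (Suc i)
    have "nx ((j0 + i) mod k) = (j0 + Suc i) mod k"
      by (simp add: nx_def mod_Suc_eq)
    then show ?case using assms(3)[OF _ Suc] k_pos by (metis mod_less_divisor)
  qed
  have "(j0 + (k - j0 + j)) mod k = j" using assms by simp
  then show ?thesis using * by metis
qed

text \<open>For a positive word every position is a rung, and three of them suffice.\<close>

lemma positive_closed_steps:
  assumes "positive w" "k \<ge> 3"
  shows "\<exists>ps. closed_steps ps \<and> length ps = 6"
proof -
  have "sg j" if "j < k" for j
    using assms(1) that by (simp add: positive_def sg_def k_def)
  then have rung: "(j, True) \<in> steps \<and> src (j, True) \<and> \<not> tgt (j, True)" if "j < k" for j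
    using that by (simp add: steps_def src_def tgt_def)
  have "\<forall>p\<in>{(0, True), (1, True), (2, True)}. p \<in> steps \<and> src p \<and> \<not> tgt p"
    using rung[of 0] rung[of 1] rung[of 2] assms(2) by simp
  from closed_steps_three_rungs[OF this] show ?thesis
    by (intro exI[of _ "[(0, True), op_step (1, True), (2, True), op_step (0, True),
      (1, True), op_step (2, True)]"]) simp
qed

text \<open>A change from positive to negative letters yields an edge \<open>U\<close>, the opposite
  change an edge \<open>V\<close>. Two edges of one kind would give a commutator of length 4, so
  there is exactly one of each, and all other positions are rungs.\<close>

lemma mixed_structure:
  assumes "\<not> positive w" "\<not> negative w" "k \<ge> 3"
    and no4: "\<forall>ps. closed_steps ps \<longrightarrow> length ps \<noteq> 4"
  obtains U V S where
    "U \<in> steps" "src U" "tgt U"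
    "V \<in> steps" "\<not> src V" "\<not> tgt V"
    "S \<in> steps" "src S" "\<not> tgt S"
    "\<forall>p\<in>steps. src p \<and> tgt p \<longrightarrow> p = U \<or> p = op_step U"
    "\<forall>p\<in>steps. \<not> src p \<and> \<not> tgt p \<longrightarrow> p = V \<or> p = op_step V"
    "k = 3 \<longrightarrow> (\<forall>p\<in>steps. src p \<and> \<not> tgt p \<longrightarrow> p = S)"
    "k \<noteq> 3 \<longrightarrow> (\<exists>S'\<in>steps. src S' \<and> \<not> tgt S' \<and> S' \<noteq> S)"
proof -
  obtain a where "a \<in> set w" "is_pos a"
    using assms(2) by (auto simp: negative_def letter.disc_eq_case split: letter.splits)
  then obtain i where i: "i < k" "sg i"
    by (auto simp: in_set_conv_nth sg_def k_def)
  obtain a' where "a' \<in> set w" "\<not> is_pos a'"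
    using assms(1) by (auto simp: positive_def)
  then obtain i' where i': "i' < k" "\<not> sg i'"
    by (auto simp: in_set_conv_nth sg_def k_def)
  have "\<exists>j<k. sg j \<and> \<not> sg (nx j)"
  proof (rule ccontr)
    \<comment> \<open>Otherwise positivity would propagate from \<open>i\<close> around the cyclic
      word to \<open>i'\<close>.\<close>
    assume no: "\<not> (\<exists>j<k. sg j \<and> \<not> sg (nx j))"
    have "sg i'"
      by (rule cyclic_index_induct[of sg i]) (use i i' no in auto)
    then show False using i' by simp
  qed
  then obtain jU where jU: "jU < k" "sg jU" "\<not> sg (nx jU)" by blast
  have "\<exists>j<k. \<not> sg j \<and> sg (nx j)"
  proof (rule ccontr)
    assume no: "\<not> (\<exists>j<k. \<not> sg j \<and> sg (nx j))"
    have "\<not> sg i"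
      by (rule cyclic_index_induct[of "\<lambda>j. \<not> sg j" i']) (use i i' no in auto)
    then show False using i by simp
  qed
  then obtain jV where jV: "jV < k" "\<not> sg jV" "sg (nx jV)" by blast
  define U V where "U = (jU, True)" and "V = (jV, True)"
  have U: "U \<in> steps" "src U" "tgt U" and V: "V \<in> steps" "\<not> src V" "\<not> tgt V"
    using jU jV by (simp_all add: U_def V_def steps_def src_def tgt_def)
  have uniqU: "p = U \<or> p = op_step U" if "p \<in> steps" "src p" "tgt p" for p
    using closed_steps_two_loops[of p U True, THEN no4[rule_format]] that U by auto
  have uniqV: "p = V \<or> p = op_step V" if "p \<in> steps" "\<not> src p" "\<not> tgt p" for p
    using closed_steps_two_loops[of p V False, THEN no4[rule_format]] that V by auto
  \<comment> \<open>Neighbouring letters have equal signs here; the direction \<open>sg j\<close>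
    makes the step run from a positive to a negative vertex.\<close>
  have rung: "(j, sg j) \<in> steps \<and> src (j, sg j) \<and> \<not> tgt (j, sg j)"
    if j: "j < k" "j \<notin> {jU, jV}" for j
  proof -
    have "(j, True) \<noteq> U" "(j, True) \<noteq> op_step U" "(j, True) \<noteq> V" "(j, True) \<noteq> op_step V"
      using j by (auto simp: U_def V_def op_step_def)
    moreover have "(j, True) \<in> steps" using j by (simp add: steps_def)
    ultimately have "src (j, True) \<noteq> tgt (j, True)"
      using uniqU uniqV by blast
    then show ?thesis
      using j by (auto simp: steps_def src_def tgt_def)
  qed
  have rung': "p = (fst p, sg (fst p)) \<and> fst p < k \<and> fst p \<notin> {jU, jV}"
    if p: "p \<in> steps" "src p" "\<not> tgt p" for p
  proof -
    have "p \<noteq> U" "p \<noteq> op_step U" "p \<noteq> V" "p \<noteq> op_step V"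
      using p U V by (metis op_steps)+
    then show ?thesis
      using p by (cases p) (auto simp: U_def V_def op_step_def steps_def src_def tgt_def split: if_splits)
  qed
  have "jU \<noteq> jV" using jU jV by auto
  then obtain j where j: "j < k" "j \<notin> {jU, jV}"
    using exists_fresh_index[of "{jU, jV}" k] assms(3) by auto
  have "p = (j, sg j)" if "k = 3" "p \<in> steps" "src p" "\<not> tgt p" for p
  proof -
    have "fst p = j"
      using rung'[OF that(2-)] j jU(1) jV(1) \<open>jU \<noteq> jV\<close> \<open>k = 3\<close> by auto
    then show ?thesis using rung'[OF that(2-)] by simp
  qed
  moreover have "\<exists>S'\<in>steps. src S' \<and> \<not> tgt S' \<and> S' \<noteq> (j, sg j)" if "k \<noteq> 3"
  proof -
    have "card {jU, jV, j} < k"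
      using card_length[of "[jU, jV, j]"] that assms(3) by simp
    then obtain j' where "j' < k" "j' \<notin> {jU, jV, j}"
      using exists_fresh_index[of "{jU, jV, j}" k] by auto
    then show ?thesis using rung[of j'] by (intro bexI[of _ "(j', sg j')"]) auto
  qed
  ultimately show ?thesis
    using U V rung[OF j] uniqU uniqV by (intro that[of U V "(j, sg j)"]) simp_all
qed

text \<open>A positive word has a closed path of length 6, as has a mixed word with a second rung;
  both are too short for \<open>q\<close>. The octagon then bounds \<open>q\<close> by 8.\<close>

lemma T_condition_bound:
  assumes T: "T_condition q (cyclic_presentation n w)" and q: "q \<ge> 7"
    and "\<not> negative w" "k \<ge> 3"
  shows "k = 3 \<and> q \<le> 8 \<and> \<not> positive w"
proof -
  have girth: "length ps \<ge> q" if "closed_steps ps" "length ps \<ge> 3" for ps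
    using T_condition_closed_steps[OF T that] .
  have pos: "\<not> positive w"
  proof
    assume "positive w"
    then obtain ps where "closed_steps ps" "length ps = 6"
      using positive_closed_steps assms(4) by blast
    then show False using girth[of ps] q by simp
  qed
  have no4: "\<forall>ps. closed_steps ps \<longrightarrow> length ps \<noteq> 4"
  proof (intro allI impI)
    fix ps assume "closed_steps ps"
    then show "length ps \<noteq> 4" using girth[of ps] q by linarith
  qed
  obtain U V S where
    U: "U \<in> steps" "src U" "tgt U" and V: "V \<in> steps" "\<not> src V" "\<not> tgt V"
    and S: "S \<in> steps" "src S" "\<not> tgt S"
    and uniqU: "\<forall>p\<in>steps. src p \<and> tgt p \<longrightarrow> p = U \<or> p = op_step U"
    and uniqV: "\<forall>p\<in>steps. \<not> src p \<and> \<not> tgt p \<longrightarrow> p = V \<or> p = op_step V"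
    and uniqS: "k = 3 \<longrightarrow> (\<forall>p\<in>steps. src p \<and> \<not> tgt p \<longrightarrow> p = S)"
    and S': "k \<noteq> 3 \<longrightarrow> (\<exists>S'\<in>steps. src S' \<and> \<not> tgt S' \<and> S' \<noteq> S)"
    by (rule mixed_structure[OF pos assms(3,4) no4])
  have "k = 3"
  proof (rule ccontr)
    assume "k \<noteq> 3"
    then obtain S' where "S' \<in> steps" "src S'" "\<not> tgt S'" "S' \<noteq> S" using S' by blast
    from girth[OF closed_steps_two_rungs[OF U V S this]] q show False by simp
  qed
  moreover have "q \<le> 8"
    using girth[OF closed_steps_octagon[OF U V S]] by simp
  ultimately show ?thesis using pos by simp
qed

lemma mixed_not_special:
  assumes sp: "special m l \<nu> (cyclic_presentation n w)" and "m \<ge> 3"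
    and "\<not> positive w" "\<not> negative w" "k \<ge> 3"
  shows False
proof -
  have girth: "length ps \<ge> 2 * m" if "closed_steps ps" for ps
    using special_closed_steps[OF sp that] .
  have no4: "\<forall>ps. closed_steps ps \<longrightarrow> length ps \<noteq> 4"
  proof (intro allI impI)
    fix ps assume "closed_steps ps"
    then show "length ps \<noteq> 4" using girth[of ps] \<open>m \<ge> 3\<close> by linarith
  qed
  obtain U V S where
    U: "U \<in> steps" "src U" "tgt U" and V: "V \<in> steps" "\<not> src V" "\<not> tgt V"
    and S: "S \<in> steps" "src S" "\<not> tgt S"
    and uniqU: "\<forall>p\<in>steps. src p \<and> tgt p \<longrightarrow> p = U \<or> p = op_step U"
    and uniqV: "\<forall>p\<in>steps. \<not> src p \<and> \<not> tgt p \<longrightarrow> p = V \<or> p = op_step V"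
    and uniqS: "k = 3 \<longrightarrow> (\<forall>p\<in>steps. src p \<and> \<not> tgt p \<longrightarrow> p = S)"
    and S': "k \<noteq> 3 \<longrightarrow> (\<exists>S'\<in>steps. src S' \<and> \<not> tgt S' \<and> S' \<noteq> S)"
    by (rule mixed_structure[OF assms(3-5) no4])
  \<comment> \<open>The reverse of \<open>V\<close> meets the same requirements with negated
    displacement, so each relation below holds for both signs, and the difference is
    \<open>2 * disp V\<close>.\<close>
  have V': "op_step V \<in> steps" "\<not> src (op_step V)" "\<not> tgt (op_step V)"
    using V by simp_all
  have no_double: "\<not> int n dvd 2 * disp V"
    using girth[OF closed_steps_double_loop(2)[OF U V S]] \<open>m \<ge> 3\<close> by auto
  have "m \<le> 4"
    using girth[OF closed_steps_octagon[OF U V S]] by simp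
  then consider "m = 3" | "m = 4" using \<open>m \<ge> 3\<close> by linarith
  then show False
  proof cases
    case 1
    then have "special 3 l \<nu> (cyclic_presentation n w)" using sp by simp
    from special_3_relation[OF U V S this uniqU] special_3_relation[OF U V' S this uniqU]
    have "int n dvd (3 * disp U + disp V) - (3 * disp U + disp (op_step V))"
      by (rule dvd_diff)
    then show False using no_double by simp
  next
    case 2
    then have sp4: "special 4 l \<nu> (cyclic_presentation n w)" using sp by simp
    \<comment> \<open>A second rung would give a closed path of length 6, below the girth 8; so the
      rung is unique.\<close>
    have "k = 3"
    proof (rule ccontr)
      assume "k \<noteq> 3"
      then obtain S' where "S' \<in> steps" "src S'" "\<not> tgt S'" "S' \<noteq> S" using S' by blast
      from girth[OF closed_steps_two_rungs[OF U V S this]] 2 show False by simp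
    qed
    with uniqS have uniqS: "\<forall>p\<in>steps. src p \<and> \<not> tgt p \<longrightarrow> p = S" by blast
    have uniqV': "\<forall>p\<in>steps. \<not> src p \<and> \<not> tgt p \<longrightarrow> p = op_step V \<or> p = op_step (op_step V)"
      using uniqV by auto
    from special_4_relation[OF U V S sp4 uniqU uniqV uniqS]
      special_4_relation[OF U V' S sp4 uniqU uniqV' uniqS]
    have "int n dvd (5 * disp U + disp V) - (5 * disp U + disp (op_step V))"
      by (rule dvd_diff)
    then show False using no_double by simp
  qed
qed

end

theorem theorem1:
  fixes n :: nat and w :: "nat word"
  assumes "n \<ge> 1"
    and "w \<in> carrier (free_group {..<n})"
    and "cyclically_reduced w"
    and "0 \<in> gen_of ` set w"
    and "\<not> redundant (cyclic_presentation n w)"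
    and "\<not> negative w"
    and "length w \<ge> 3"
    and "\<not> proper_power {..<n} w"
  shows "(\<forall>q\<ge>7. T_condition q (cyclic_presentation n w) \<longrightarrow>
            length w = 3 \<and> q \<le> 8 \<and> \<not> positive w) \<and>
         (\<not> positive w \<and> length w = 3 \<longrightarrow>
            (\<forall>m\<ge>2. \<forall>\<nu>\<ge>1. \<not> special m 3 \<nu> (cyclic_presentation n w))) \<and>
         (\<forall>m\<ge>2. \<forall>k\<ge>3. \<forall>\<nu>\<ge>1. special m k \<nu> (cyclic_presentation n w) \<longrightarrow>
            m = 2 \<or> (m = 3 \<and> positive w))"
proof -
  interpret cyclic_relator n w
    using assms by unfold_locales auto
  have k: "k \<ge> 3" using assms(7) by (simp add: k_def)
  have mixed: "positive w" if "special m l \<nu> (cyclic_presentation n w)" "m \<ge> 3" for m l \<nu>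
    using mixed_not_special[OF that] assms(6) k by blast
  show ?thesis
  proof (intro conjI allI impI)
    fix q assume "q \<ge> 7" "T_condition q (cyclic_presentation n w)"
    then have "k = 3 \<and> q \<le> 8 \<and> \<not> positive w"
      using T_condition_bound assms(6) k by blast
    then show "length w = 3" "q \<le> 8" "\<not> positive w" by (simp_all add: k_def)
  next
    fix m \<nu> :: nat
    assume "m \<ge> 2" and w: "\<not> positive w \<and> length w = 3"
    show "\<not> special m 3 \<nu> (cyclic_presentation n w)"
    proof
      assume sp: "special m 3 \<nu> (cyclic_presentation n w)"
      \<comment> \<open>For \<open>m = 2\<close> specialness demands relators of length at least
        4.\<close>
      then have "m \<noteq> 2"
        unfolding special_def cyclic_presentation_def prod.case by linarith
      then show False using mixed[OF sp] w \<open>m \<ge> 2\<close> by simp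
    qed
  next
    fix m l \<nu> :: nat
    assume "m \<ge> 2" and sp: "special m l \<nu> (cyclic_presentation n w)"
    show "m = 2 \<or> m = 3 \<and> positive w"
    proof (cases "m = 2")
      case False
      then have pos: "positive w" using mixed[OF sp] \<open>m \<ge> 2\<close> by simp
      then obtain ps where "closed_steps ps" "length ps = 6"
        using positive_closed_steps k by blast
      then have "m \<le> 3" using special_closed_steps[OF sp, of ps] by simp
      then show ?thesis using pos False \<open>m \<ge> 2\<close> by simp
    qed simp
  qed
qed

end
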